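(* Let $N\ge2$, $q>p-1>0$, and let $\Omega\subset\mathbb{R}^N$ be a bounded domain with $C^2$ boundary. Write $d(x)=\operatorname{dist}(x,\partial\Omega)$ and $\beta_q=\frac{p-q}{q+1-p}$. Then there exists $\delta_*>0$ such that, with $\Omega_{\delta_*}:=\{z\in\Omega:d(z)\le\delta_*\}$, any solution $u\in C^2(\Omega)$ of $-\Delta_pu+|\nabla u|^q=0$ in $\Omega$ satisfies $$|u(x)|\le c_{N,p,q}\left|(d(x))^{-\beta_q}-\delta_*^{-\beta_q}\right|+\max\{|u(z)|:d(z)=\delta_*\}\qquad\forall x\in\Omega_{\delta_*}$$ if $p\ne q$, and $$|u(x)|\le c_{N,p,q}\big(\ln\delta_*-\ln d(x)\big)+\max\{|u(z)|:d(z)=\delta_*\}\qquad\forall x\in\Omega_{\delta_*}$$ if $p=q$, where $c_{N,p,q}>0$ depends only on $N,p,q$.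
   Context: $\Delta_p u=\operatorname{div}(|\nabla u|^{p-2}\nabla u)$; solutions are understood in the distributional sense. *)

theory Defs
  imports "HOL-Analysis.Analysis"
begin

definition grad :: "('a::euclidean_space \<Rightarrow> real) \<Rightarrow> 'a \<Rightarrow> 'a" where
  "grad f x = (THE D. GDERIV f x :> D)"

text \<open>The class \<open>C\<^sup>k(S)\<close>, for open \<open>S\<close>: all partial derivatives up to order \<open>k\<close> exist and are
  continuous on \<open>S\<close>. Here \<open>grad f x \<bullet> b\<close> is the partial derivative in the coordinate direction \<open>b\<close>.
  Only values of \<open>f\<close> on the open set \<open>S\<close> matter.\<close>

fun Ck_on :: "nat \<Rightarrow> ('a::euclidean_space \<Rightarrow> real) \<Rightarrow> 'a set \<Rightarrow> bool" where
  "Ck_on 0 f S \<longleftrightarrow> continuous_on S f"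
| "Ck_on (Suc k) f S \<longleftrightarrow>
     (\<forall>x\<in>S. f differentiable (at x)) \<and> (\<forall>b\<in>Basis. Ck_on k (\<lambda>x. grad f x \<bullet> b) S)"

definition test_function :: "'a::euclidean_space set \<Rightarrow> ('a \<Rightarrow> real) \<Rightarrow> bool" where
  "test_function \<Omega> \<phi> \<longleftrightarrow>
     (\<forall>k. Ck_on k \<phi> UNIV) \<and> compact (closure {x. \<phi> x \<noteq> 0}) \<and> closure {x. \<phi> x \<noteq> 0} \<subseteq> \<Omega>"

text \<open>A domain is a nonempty connected open set.\<close>

definition is_domain :: "'a::euclidean_space set \<Rightarrow> bool" where
  "is_domain \<Omega> \<longleftrightarrow> open \<Omega> \<and> connected \<Omega> \<and> \<Omega> \<noteq> {}"

text \<open>Near each boundary point, \<open>\<Omega>\<close> is the strict epigraph, in some direction \<open>\<nu>\<close>, of a \<open>C\<^sup>2\<close> function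
  on the hyperplane orthogonal to \<open>\<nu>\<close>. The point \<open>x - (x \<bullet> \<nu>) \<nu>\<close> is the orthogonal projection of \<open>x\<close> to
  that hyperplane, so only the values of \<open>\<gamma>\<close> there are used; a \<open>C\<^sup>2\<close> function on the hyperplane
  always extends to the whole space by composing it with this projection.\<close>

definition C2_boundary :: "'a::euclidean_space set \<Rightarrow> bool" where
  "C2_boundary \<Omega> \<longleftrightarrow>
     (\<forall>x0\<in>frontier \<Omega>. \<exists>r>0. \<exists>\<nu> \<gamma>. norm \<nu> = 1 \<and> Ck_on 2 \<gamma> UNIV \<and>
        \<Omega> \<inter> ball x0 r = {x \<in> ball x0 r. x \<bullet> \<nu> > \<gamma> (x - (x \<bullet> \<nu>) *\<^sub>R \<nu>)})"

abbreviation bdist :: "'a::euclidean_space set \<Rightarrow> 'a \<Rightarrow> real" where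
  "bdist \<Omega> x \<equiv> infdist x (frontier \<Omega>)"

text \<open>The vector field \<open>|\<nabla>u|\<^sup>p\<^sup>-\<^sup>2 \<nabla>u\<close>, which is \<open>0\<close> wherever \<open>\<nabla>u\<close> vanishes (its continuous extension
  when \<open>1 < p < 2\<close>).\<close>

definition p_flux :: "real \<Rightarrow> ('a::euclidean_space \<Rightarrow> real) \<Rightarrow> 'a \<Rightarrow> 'a" where
  "p_flux p u x = (norm (grad u x) powr (p - 2)) *\<^sub>R grad u x"

text \<open>\<open>- div (|\<nabla>u|\<^sup>p\<^sup>-\<^sup>2 \<nabla>u) + |\<nabla>u|\<^sup>q = 0\<close> in the sense of distributions on \<open>\<Omega>\<close>. It is meant for \<open>u\<close> of
  class \<open>C\<^sup>1\<close> on the open set \<open>\<Omega>\<close> and for \<open>p > 1\<close>, \<open>q > 0\<close>; both integrands are then continuous with compact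
  support in \<open>\<Omega>\<close>, hence integrable.\<close>

definition distributional_solution ::
    "real \<Rightarrow> real \<Rightarrow> 'a::euclidean_space set \<Rightarrow> ('a \<Rightarrow> real) \<Rightarrow> bool" where
  "distributional_solution p q \<Omega> u \<longleftrightarrow>
     (\<forall>\<phi>. test_function \<Omega> \<phi> \<longrightarrow>
        (LINT x:\<Omega>|lborel. p_flux p u x \<bullet> grad \<phi> x)
        + (LINT x:\<Omega>|lborel. norm (grad u x) powr q * \<phi> x) = 0)"

text \<open>\<open>max {|u(z)| : z \<in> \<Omega>, d(z) = \<delta>}\<close>. For \<open>u\<close> continuous on a bounded open \<open>\<Omega>\<close> and \<open>\<delta> > 0\<close> the
  level set is compact, so the maximum exists as soon as the level set is nonempty.\<close>

definition level_max :: "'a::euclidean_space set \<Rightarrow> ('a \<Rightarrow> real) \<Rightarrow> real \<Rightarrow> real" where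
  "level_max \<Omega> u \<delta> = (GREATEST m. m \<in> {\<bar>u z\<bar> |z. z \<in> \<Omega> \<and> bdist \<Omega> z = \<delta>})"

definition \<beta> :: "real \<Rightarrow> real \<Rightarrow> real" where
  "\<beta> p q = (p - q) / (q + 1 - p)"

end

theory Submission
  imports Defs
begin

text \<open>The heart of the matter is the universal interior gradient bound
  \<open>|\<nabla>u(x)| \<le> C R\<^bsup>-1/(q+1-p)\<^esup>\<close> whenever the ball of radius \<open>R\<close> about \<open>x\<close> lies in \<open>\<Omega>\<close>. Bernstein's method
  would differentiate the equation, which a \<open>C\<^sup>2\<close> solution does not allow. Instead the variables are
  doubled: one maximises \<open>u(y) - u(x) - |y - x|\<^sup>2 / (2 \<epsilon> \<rho>(x)\<^sup>m)\<close> with \<open>\<rho>(x) = R\<^sup>2 - |x - x0|\<^sup>2\<close> and uses the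
  first and second order conditions at the maximum together with the equation at both \<open>x\<close> and \<open>y\<close>. Both
  gradients are nonzero there, so the equation holds pointwise in nondivergence form. As \<open>\<epsilon> \<rightarrow> 0\<close> the maximal
  value, divided by \<open>\<epsilon>\<close>, tends to half the maximum of \<open>\<rho>\<^sup>m |\<nabla>u|\<^sup>2\<close>.

  Near the boundary, moving a distance \<open>t\<close> in a suitable inward direction increases the distance to the
  boundary by at least \<open>t/2\<close>, so integrating the gradient bound up to the level \<open>d = \<delta>\<close> gives the
  estimate.\<close>

section \<open>Gradient and Hessian of twice differentiable functions\<close>

text \<open>The exponent comes from scaling: at length R the equation balances |grad u|^(p-1) / R
  against |grad u|^q, so |grad u| is of order R^(-1/(q+1-p)). Integrated, this is a multiple of the
  power with exponent \<open>- \<beta> p q\<close>, or the logarithm when p = q. The degeneracy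
  shapes the proof: the equation is read pointwise only where the gradient does not vanish, as
  trace(A(n) Hess u) = |grad u|^s with s = q - p + 2, n the direction of the gradient and A(n) = 1 +
  (p - 2) n n^T. The two points of the doubling carry different matrices A. This costs |difference
  of directions|^2 / \<epsilon>, and the directions differ by O(\<epsilon>), so the cost is
  O(\<epsilon>), of the same order as the gain. The weight \<rho>^m keeps the maximum away from the
  sphere although nothing is known about u there. At the unknown maximum point one obtains \<rho>
  P^(s-1) \<le> C R with P = |grad u(y)|; choosing m \<ge> 2/(s-1) turns this into a bound for
  \<rho>^m P^2, which is compared with the centre. Bounds for the gradient and the Hessian on the
  ball depend on u, but they only say how small \<epsilon> must be and enter an error vanishing with
  \<epsilon>, so the final constant depends on N, p, q only.\<close>

lemma has_derivative_grad:
  assumes "f differentiable (at x)"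
  shows "(f has_derivative (\<lambda>h. grad f x \<bullet> h)) (at x)"
proof -
  obtain f' where f': "(f has_derivative f') (at x)"
    using assms by (auto simp: differentiable_def)
  have rep: "f' h = (\<Sum>b\<in>Basis. f' b *\<^sub>R b) \<bullet> h" for h
  proof -
    interpret linear f' using f' has_derivative_linear by blast
    have "f' h = f' (\<Sum>b\<in>Basis. (h \<bullet> b) *\<^sub>R b)"
      by (simp add: euclidean_representation)
    also have "\<dots> = (\<Sum>b\<in>Basis. (h \<bullet> b) * f' b)"
      by (simp add: sum scale)
    also have "\<dots> = (\<Sum>b\<in>Basis. f' b *\<^sub>R b) \<bullet> h"
      by (simp add: inner_sum_left inner_commute[of h] mult.commute)
    finally show ?thesis .
  qed
  have g: "GDERIV f x :> (\<Sum>b\<in>Basis. f' b *\<^sub>R b)"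
    unfolding gderiv_def
    by (rule has_derivative_eq_rhs[OF f'], rule ext, subst inner_commute, rule rep)
  have uq: "D = E" if "GDERIV f x :> D" "GDERIV f x :> E" for D E
    using has_derivative_unique[OF that[unfolded gderiv_def]] vector_eq_ldot[of D E]
    by (auto simp: fun_eq_iff)
  have "GDERIV f x :> grad f x"
    unfolding grad_def by (rule theI[of "\<lambda>D. GDERIV f x :> D", OF g]) (rule uq[OF _ g])
  then show ?thesis by (simp add: gderiv_def inner_commute)
qed

lemma grad_unique:
  assumes "(f has_derivative (\<lambda>h. D \<bullet> h)) (at x)"
  shows "grad f x = D"
proof -
  have "(f has_derivative (\<lambda>h. grad f x \<bullet> h)) (at x)"
    using assms by (intro has_derivative_grad) (auto simp: differentiable_def)
  from has_derivative_unique[OF this assms] show ?thesis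
    using vector_eq_rdot[of "grad f x" D] by (auto simp: fun_eq_iff)
qed

text \<open>The Jacobian of \<open>grad u\<close> as a linear map, assembled row by row because
  \<open>Ck_on\<close> speaks of partial derivatives only.\<close>

definition hess :: "('a::euclidean_space \<Rightarrow> real) \<Rightarrow> 'a \<Rightarrow> 'a \<Rightarrow> 'a" where
  "hess u x h = (\<Sum>b\<in>Basis. (grad (\<lambda>z. grad u z \<bullet> b) x \<bullet> h) *\<^sub>R b)"

lemma linear_hess: "linear (hess u x)"
  unfolding hess_def
  by (rule linearI)
    (simp_all add: inner_add_right scaleR_add_left sum.distrib scaleR_sum_right)

lemma C2_differentiable:
  assumes "Ck_on 2 u S" "x \<in> S"
  shows "u differentiable (at x)"
    and "b \<in> Basis \<Longrightarrow> (\<lambda>z. grad u z \<bullet> b) differentiable (at x)"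
  using assms by (auto simp: numeral_2_eq_2)

lemma C2_continuous:
  assumes "Ck_on 2 u S" "b \<in> Basis" "c \<in> Basis"
  shows "continuous_on S (\<lambda>x. grad (\<lambda>z. grad u z \<bullet> b) x \<bullet> c)"
  using assms by (auto simp: numeral_2_eq_2)

lemma has_derivative_grad_hess:
  assumes "Ck_on 2 u S" "x \<in> S"
  shows "(grad u has_derivative hess u x) (at x)"
proof -
  have "((\<lambda>z. \<Sum>b\<in>Basis. (grad u z \<bullet> b) *\<^sub>R b) has_derivative hess u x) (at x)"
    unfolding hess_def
    by (intro has_derivative_sum has_derivative_scaleR_left has_derivative_grad
        C2_differentiable[OF assms])
  then show ?thesis by (simp add: euclidean_representation)
qed

lemma continuous_on_grad:
  assumes "Ck_on 2 u S"
  shows "continuous_on S (grad u)"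
  using has_derivative_grad_hess[OF assms]
  by (meson continuous_at_imp_continuous_on has_derivative_continuous)

lemma continuous_on_C2:
  assumes "Ck_on 2 u S"
  shows "continuous_on S u"
  by (meson assms C2_differentiable(1) continuous_at_imp_continuous_on differentiable_imp_continuous_within)

lemma continuous_on_hess:
  assumes "Ck_on 2 u S"
  shows "continuous_on S (\<lambda>x. hess u x h)"
proof -
  have "hess u x h = (\<Sum>b\<in>Basis. (\<Sum>c\<in>Basis. (grad (\<lambda>z. grad u z \<bullet> b) x \<bullet> c) * (h \<bullet> c)) *\<^sub>R b)" for x
    unfolding hess_def by (simp add: euclidean_inner[of _ h])
  then show ?thesis
    by (simp, intro continuous_intros C2_continuous[OF assms]) auto
qed

text \<open>Compactness bounds the image of each basis vector, and expanding \<open>h\<close> in the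
  basis adds these bounds up. Later \<open>H\<close> enters only error terms that vanish with
  \<epsilon>.\<close>

lemma hess_bound:
  assumes "Ck_on 2 u S" "compact K" "K \<subseteq> S"
  obtains H where "H \<ge> 0" "\<And>x h. x \<in> K \<Longrightarrow> norm (hess u x h) \<le> H * norm h"
proof -
  have "\<exists>B\<ge>0. \<forall>x\<in>K. norm (hess u x b) \<le> B" for b
  proof -
    have "compact ((\<lambda>x. hess u x b) ` K)"
      by (rule compact_continuous_image[OF continuous_on_subset[OF continuous_on_hess[OF assms(1)] assms(3)] assms(2)])
    then show ?thesis
      by (metis (mono_tags, lifting) bounded_normE compact_imp_bounded imageI less_imp_le bounded_pos)
  qed
  then obtain B where B: "\<And>b. B b \<ge> 0" "\<And>b x. x \<in> K \<Longrightarrow> norm (hess u x b) \<le> B b" by metis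
  show ?thesis
  proof
    show "0 \<le> (\<Sum>b\<in>Basis. B b)" using B(1) by (simp add: sum_nonneg)
    fix x h :: 'a assume "x \<in> K"
    have "hess u x h = (\<Sum>b\<in>Basis. (h \<bullet> b) *\<^sub>R hess u x b)"
      using linear_sum[OF linear_hess, of u x "\<lambda>b. (h \<bullet> b) *\<^sub>R b" Basis]
      by (simp add: euclidean_representation linear_cmul[OF linear_hess])
    also have "norm \<dots> \<le> (\<Sum>b\<in>Basis. norm h * B b)"
      by (rule sum_norm_le)
        (auto intro!: mult_mono simp: Basis_le_norm B \<open>x \<in> K\<close>)
    finally show "norm (hess u x h) \<le> (\<Sum>b\<in>Basis. B b) * norm h"
      by (simp add: sum_distrib_left mult.commute)
  qed
qed

lemma DERIV_along_line:
  assumes "Ck_on 2 u S" "y + t *\<^sub>R v \<in> S"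
  shows "((\<lambda>t. u (y + t *\<^sub>R v)) has_real_derivative grad u (y + t *\<^sub>R v) \<bullet> v) (at t)"
    and "((\<lambda>t. grad u (y + t *\<^sub>R v) \<bullet> v) has_real_derivative hess u (y + t *\<^sub>R v) v \<bullet> v) (at t)"
proof -
  have l: "((\<lambda>t. y + t *\<^sub>R v) has_derivative (\<lambda>t. t *\<^sub>R v)) (at t)"
    by (auto intro!: derivative_eq_intros)
  have "((\<lambda>t. u (y + t *\<^sub>R v)) has_derivative (\<lambda>s. grad u (y + t *\<^sub>R v) \<bullet> (s *\<^sub>R v))) (at t)"
    by (rule has_derivative_compose[OF l has_derivative_grad[OF C2_differentiable(1)[OF assms]]])
  then show "((\<lambda>t. u (y + t *\<^sub>R v)) has_real_derivative grad u (y + t *\<^sub>R v) \<bullet> v) (at t)"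
    by (rule has_derivative_imp_has_field_derivative) simp
  have "((\<lambda>t. grad u (y + t *\<^sub>R v)) has_derivative (\<lambda>s. hess u (y + t *\<^sub>R v) (s *\<^sub>R v))) (at t)"
    by (rule has_derivative_compose[OF l has_derivative_grad_hess[OF assms]])
  then have "((\<lambda>t. grad u (y + t *\<^sub>R v) \<bullet> v) has_derivative (\<lambda>s. hess u (y + t *\<^sub>R v) (s *\<^sub>R v) \<bullet> v)) (at t)"
    by (rule has_derivative_inner_left)
  then show "((\<lambda>t. grad u (y + t *\<^sub>R v) \<bullet> v) has_real_derivative hess u (y + t *\<^sub>R v) v \<bullet> v) (at t)"
    by (rule has_derivative_imp_has_field_derivative) (simp add: linear_cmul[OF linear_hess])
qed

lemma grad_lipschitz:
  assumes "Ck_on 2 u S" "K \<subseteq> S" "convex K"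
    and "\<And>x h. x \<in> K \<Longrightarrow> norm (hess u x h) \<le> H * norm h" "x \<in> K" "y \<in> K"
  shows "norm (grad u x - grad u y) \<le> H * norm (x - y)"
proof (rule differentiable_bound[OF assms(3)])
  have H: "H \<ge> 0"
    using order_trans[OF norm_ge_zero assms(4)[OF assms(5), of "SOME b. b \<in> Basis"]] by simp
  fix z assume z: "z \<in> K"
  show "(grad u has_derivative hess u z) (at z within K)"
    using has_derivative_grad_hess[OF assms(1)] z assms(2) has_derivative_at_withinI by blast
  show "onorm (hess u z) \<le> H"
    by (rule onorm_bound[OF _ assms(4)[OF z]]) (rule H)
qed (use assms in auto)

text \<open>If \<open>c\<close> were positive, \<open>f'\<close>, which vanishes at 0, would be
  positive just to the right of 0, and \<open>f\<close> would increase strictly there.\<close>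

lemma second_derivative_nonpos_at_local_max:
  fixes f :: "real \<Rightarrow> real"
  assumes r: "r > 0" and f: "\<And>t. \<bar>t\<bar> < r \<Longrightarrow> (f has_real_derivative f' t) (at t)"
    and f': "(f' has_real_derivative c) (at 0)" and le: "\<And>t. \<bar>t\<bar> < r \<Longrightarrow> f t \<le> f 0"
  shows "f' 0 = 0" "c \<le> 0"
proof -
  show 0: "f' 0 = 0"
    using DERIV_local_max[OF f[of 0] r] le r by simp
  show "c \<le> 0"
  proof (rule ccontr)
    assume "\<not> c \<le> 0"
    then obtain d where d: "d > 0" "\<And>h. 0 < h \<Longrightarrow> h < d \<Longrightarrow> f' 0 < f' (0 + h)"
      using DERIV_pos_inc_right[OF f'] by auto
    define h where "h = min d r / 2"
    have h: "0 < h" "h < d" "h < r" using d(1) r by (auto simp: h_def)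
    have "continuous_on {0..h} f"
      using f h by (intro continuous_at_imp_continuous_on ballI DERIV_isCont[OF f]) auto
    moreover have "(f has_real_derivative f' t) (at t) \<and> f' t > 0" if "0 < t" "t < h" for t
      using f[of t] d(2)[of t] 0 that h by simp
    ultimately have "f 0 < f h"
      using DERIV_pos_imp_increasing_open[OF h(1), of f] by blast
    then show False using le[of h] h by simp
  qed
qed

section \<open>Bump functions and integration by parts\<close>

text \<open>The standard flat function exp(-1/t) is the case \<open>k = 0\<close>; the other members
  are what differentiation produces, so their span is closed under it.\<close>

definition flat_exp :: "nat \<Rightarrow> real \<Rightarrow> real" where
  "flat_exp k t = (if t > 0 then exp (- (1 / t)) * (1 / t) ^ k else 0)"

text \<open>A single term of the exponential series, the one of order \<open>k + 2\<close>, bounds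
  exp(1/t) from below. The resulting decay of order t^2 gives derivative 0 at the origin.\<close>

lemma flat_exp_le: "\<bar>flat_exp k t\<bar> \<le> fact (k + 2) * t\<^sup>2"
proof (cases "t > 0")
  case True
  have "(1 / t) ^ (k + 2) / fact (k + 2) \<le> exp (1 / t)"
    using True sum_le_suminf[OF summable_exp[of "1 / t"], of "{k + 2}"]
    by (simp add: exp_def field_simps)
  then have "(1 / t) ^ (k + 2) \<le> exp (1 / t) * fact (k + 2)"
    by (simp only: divide_le_eq fact_gt_zero if_True)
  then have "(1 / t) ^ (k + 2) * exp (- (1 / t)) \<le> exp (1 / t) * fact (k + 2) * exp (- (1 / t))"
    by (rule mult_right_mono) simp
  also have "\<dots> = fact (k + 2) * (exp (1 / t) * exp (- (1 / t)))"
    by (simp only: ac_simps)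
  also have "\<dots> = fact (k + 2)"
    by (simp only: exp_minus_inverse mult_1_right)
  finally have "(1 / t) ^ (k + 2) * exp (- (1 / t)) \<le> fact (k + 2)" .
  then have "(1 / t) ^ (k + 2) * exp (- (1 / t)) * t\<^sup>2 \<le> fact (k + 2) * t\<^sup>2"
    by (rule mult_right_mono) simp
  also have "(1 / t) ^ (k + 2) * exp (- (1 / t)) * t\<^sup>2 = flat_exp k t"
    using True by (simp add: flat_exp_def power_add power_divide power2_eq_square)
  finally show ?thesis
    using True by (simp add: flat_exp_def)
qed (simp add: flat_exp_def)

lemma DERIV_flat_exp:
  "(flat_exp k has_real_derivative flat_exp (k + 2) t - k * flat_exp (k + 1) t) (at t)"
proof (cases t "0::real" rule: linorder_cases)
  case less
  have "((\<lambda>_. 0) has_real_derivative 0) (at t)" by simp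
  then have "(flat_exp k has_real_derivative 0) (at t)"
    by (rule has_field_derivative_transform_within_open[of _ _ _ "{..<0}"])
      (use less in \<open>auto simp: flat_exp_def\<close>)
  then show ?thesis using less by (simp add: flat_exp_def)
next
  case equal
  have "((\<lambda>h. flat_exp k h / h) \<longlongrightarrow> 0) (at 0)"
  proof (rule Lim_null_comparison)
    have "norm (flat_exp k h / h) \<le> fact (k + 2) * \<bar>h\<bar>" if "h \<noteq> 0" for h
      using divide_right_mono[OF flat_exp_le[of k h], of "\<bar>h\<bar>"] that
      by (simp add: power2_eq_square abs_mult_self_eq[of h, symmetric] del: abs_mult_self_eq fact_Suc)
    then show "\<forall>\<^sub>F h in at 0. norm (flat_exp k h / h) \<le> fact (k + 2) * \<bar>h\<bar>"
      by (auto simp: eventually_at intro: exI[of _ 1])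
    show "((\<lambda>h. fact (k + 2) * \<bar>h\<bar>) \<longlongrightarrow> (0::real)) (at 0)"
      by (auto intro!: tendsto_eq_intros)
  qed
  then show ?thesis using equal
    by (simp add: has_field_derivative_iff flat_exp_def)
next
  case greater
  have inv: "((\<lambda>t. 1 / t) has_real_derivative - (1 / t)\<^sup>2) (at t)"
    using greater by (auto intro!: derivative_eq_intros simp: power2_eq_square)
  have "((\<lambda>t. exp (- (1 / t))) has_real_derivative exp (- (1 / t)) * (1 / t)\<^sup>2) (at t)"
    using DERIV_chain2[OF DERIV_exp DERIV_minus[OF inv]] by simp
  from DERIV_mult[OF this DERIV_power[OF inv, of k]]
  have "((\<lambda>t. exp (- (1 / t)) * (1 / t) ^ k) has_real_derivative
      flat_exp (k + 2) t - k * flat_exp (k + 1) t) (at t)"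
    by (rule DERIV_cong) (use greater in \<open>cases k; simp add: flat_exp_def power2_eq_square algebra_simps\<close>)
  then show ?thesis
    by (rule has_field_derivative_transform_within_open[of _ _ _ "{0<..}"])
      (use greater in \<open>auto simp: flat_exp_def\<close>)
qed

text \<open>An algebra of functions closed under partial derivatives, which yields \<open>C\<^sup>\<infinity>\<close> regularity by
  induction on the order.\<close>

inductive bump_algebra :: "'a::euclidean_space \<Rightarrow> real \<Rightarrow> ('a \<Rightarrow> real) \<Rightarrow> bool" for a r where
  const: "bump_algebra a r (\<lambda>_. c)"
| coord: "bump_algebra a r (\<lambda>x. x \<bullet> b)"
| flat: "bump_algebra a r (\<lambda>x. flat_exp k (r\<^sup>2 - (norm (x - a))\<^sup>2))"
| add: "bump_algebra a r f \<Longrightarrow> bump_algebra a r g \<Longrightarrow> bump_algebra a r (\<lambda>x. f x + g x)"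
| mult: "bump_algebra a r f \<Longrightarrow> bump_algebra a r g \<Longrightarrow> bump_algebra a r (\<lambda>x. f x * g x)"

lemma bump_algebra_derivative:
  assumes "bump_algebra a r f"
  shows "\<exists>D. (\<forall>x. (f has_derivative (\<lambda>h. D x \<bullet> h)) (at x)) \<and>
    (\<forall>b. bump_algebra a r (\<lambda>x. D x \<bullet> b))"
  using assms
proof induction
  case (const c)
  show ?case
    by (rule exI[of _ "\<lambda>_. 0"]) (auto intro: bump_algebra.const)
next
  case (coord b)
  show ?case
    by (rule exI[of _ "\<lambda>_. b"])
      (auto intro!: bump_algebra.const derivative_eq_intros simp: inner_commute)
next
  case (flat k)
  let ?s = "\<lambda>x. r\<^sup>2 - (norm (x - a))\<^sup>2"
  let ?d = "\<lambda>x. flat_exp (k + 2) (?s x) + (- real k) * flat_exp (k + 1) (?s x)"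
  have "((\<lambda>x. flat_exp k (?s x)) has_derivative (\<lambda>h. ((-2 * ?d x) *\<^sub>R (x - a)) \<bullet> h)) (at x)" for x
  proof -
    have s: "(?s has_derivative (\<lambda>h. - 2 * ((x - a) \<bullet> h))) (at x)"
      unfolding power2_norm_eq_inner
      by (auto intro!: derivative_eq_intros simp: inner_commute)
    have "((\<lambda>x. flat_exp k (?s x)) has_derivative
        (\<lambda>h. (flat_exp (k + 2) (?s x) - k * flat_exp (k + 1) (?s x)) * (- 2 * ((x - a) \<bullet> h)))) (at x)"
      by (rule has_derivative_compose[OF s DERIV_flat_exp[THEN has_field_derivative_imp_has_derivative]])
    then show ?thesis
      by (rule has_derivative_eq_rhs) (auto simp: algebra_simps)
  qed
  moreover have "bump_algebra a r (\<lambda>x. ((-2 * ?d x) *\<^sub>R (x - a)) \<bullet> b)" for b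
  proof -
    have "bump_algebra a r (\<lambda>x. (-2 * ?d x) * (x \<bullet> b + - (a \<bullet> b)))"
      by (intro bump_algebra.intros)
    moreover have "((-2 * ?d x) *\<^sub>R (x - a)) \<bullet> b = (-2 * ?d x) * (x \<bullet> b + - (a \<bullet> b))" for x
      by (simp only: inner_scaleR_left inner_diff_left) simp
    ultimately show ?thesis by (simp only:)
  qed
  ultimately show ?case
    by (intro exI[of _ "\<lambda>x. (-2 * ?d x) *\<^sub>R (x - a)"]) blast
next
  case (add f g)
  then obtain D E where
    "\<And>x. (f has_derivative (\<lambda>h. D x \<bullet> h)) (at x)" "\<And>b. bump_algebra a r (\<lambda>x. D x \<bullet> b)"
    "\<And>x. (g has_derivative (\<lambda>h. E x \<bullet> h)) (at x)" "\<And>b. bump_algebra a r (\<lambda>x. E x \<bullet> b)"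
    by blast
  then show ?case
    by (intro exI[of _ "\<lambda>x. D x + E x"])
      (auto simp: inner_add_left intro!: bump_algebra.add has_derivative_add)
next
  case (mult f g)
  then obtain D E where
    "\<And>x. (f has_derivative (\<lambda>h. D x \<bullet> h)) (at x)" "\<And>b. bump_algebra a r (\<lambda>x. D x \<bullet> b)"
    "\<And>x. (g has_derivative (\<lambda>h. E x \<bullet> h)) (at x)" "\<And>b. bump_algebra a r (\<lambda>x. E x \<bullet> b)"
    by blast
  with mult.hyps show ?case
    by (intro exI[of _ "\<lambda>x. g x *\<^sub>R D x + f x *\<^sub>R E x"])
      (auto simp: inner_add_left mult.commute intro!: bump_algebra.add bump_algebra.mult derivative_eq_intros)
qed

lemma bump_algebra_Ck_on:
  assumes "bump_algebra a r f"
  shows "Ck_on k f UNIV"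
  using assms
proof (induction k arbitrary: f)
  case 0
  then obtain D where "\<And>x. (f has_derivative (\<lambda>h. D x \<bullet> h)) (at x)"
    using bump_algebra_derivative by blast
  then show ?case
    by (simp, meson continuous_at_imp_continuous_on has_derivative_continuous)
next
  case (Suc k)
  then obtain D where D: "\<And>x. (f has_derivative (\<lambda>h. D x \<bullet> h)) (at x)" "\<And>b. bump_algebra a r (\<lambda>x. D x \<bullet> b)"
    using bump_algebra_derivative by blast
  then have "grad f x = D x" for x by (simp add: grad_unique)
  with D Suc.IH show ?case by (auto simp: differentiable_def)
qed

text \<open>The function \<open>flat_exp 0\<close> of r^2 - |x - a|^2 is smooth everywhere and
  positive exactly in the open ball; its support is the closed ball, which is why that ball has to
  lie in \<open>\<Omega>\<close>.\<close>

lemma bump_exists: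
  fixes a :: "'a::euclidean_space"
  assumes "r > 0" "cball a r \<subseteq> \<Omega>"
  obtains \<phi> where "test_function \<Omega> \<phi>" "\<And>x. \<phi> x \<ge> 0" "\<And>x. \<phi> x > 0 \<longleftrightarrow> x \<in> ball a r"
proof
  let ?\<phi> = "\<lambda>x. flat_exp 0 (r\<^sup>2 - (norm (x - a))\<^sup>2)"
  show pos: "?\<phi> x > 0 \<longleftrightarrow> x \<in> ball a r" for x
    using assms(1) power2_less_imp_less[of "norm (x - a)" r]
      power_strict_mono[of "norm (x - a)" r 2]
    by (auto simp: flat_exp_def dist_norm norm_minus_commute)
  show nonneg: "?\<phi> x \<ge> 0" for x by (simp add: flat_exp_def)
  have "{x. ?\<phi> x \<noteq> 0} = ball a r"
    using pos nonneg by (intro set_eqI) (metis (mono_tags, lifting) mem_Collect_eq less_le)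
  then show "test_function \<Omega> ?\<phi>"
    using assms by (auto simp: test_function_def intro: bump_algebra_Ck_on bump_algebra.flat)
qed

text \<open>By translation invariance every difference quotient of \<open>g\<close> in direction
  \<open>b\<close> has integral zero. Dominated convergence passes this to the derivative, the
  dominating function being \<open>M\<close> on a ball.\<close>

lemma integral_partial_derivative_zero:
  fixes g :: "'a::euclidean_space \<Rightarrow> real"
  assumes der: "\<And>x. (g has_derivative (\<lambda>h. D x \<bullet> h)) (at x)"
    and supp: "\<And>x. x \<notin> cball a r \<Longrightarrow> g x = 0"
    and bd: "\<And>x. \<bar>D x \<bullet> b\<bar> \<le> M"
  shows "integrable lborel (\<lambda>x. D x \<bullet> b)" "(LINT x|lborel. D x \<bullet> b) = 0"
proof -
  define s where "s n x = real (Suc n) * (g (x + (1 / Suc n) *\<^sub>R b) - g x)" for n x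
  have M: "M \<ge> 0" using bd[of undefined] by linarith
  have cont: "continuous_on UNIV g"
    by (meson der continuous_at_imp_continuous_on has_derivative_continuous)
  then have meas[measurable]: "g \<in> borel_measurable borel"
    by (rule borel_measurable_continuous_onI)
  have line: "((\<lambda>t. g (x + t *\<^sub>R b)) has_real_derivative D (x + t *\<^sub>R b) \<bullet> b) (at t)" for x t
  proof -
    have "((\<lambda>t. g (x + t *\<^sub>R b)) has_derivative (\<lambda>s. D (x + t *\<^sub>R b) \<bullet> (s *\<^sub>R b))) (at t)"
      by (rule has_derivative_compose[OF _ der]) (auto intro!: derivative_eq_intros)
    then show ?thesis
      by (rule has_derivative_imp_has_field_derivative) simp
  qed
  \<comment> \<open>The shifts by b / (n + 1) have length at most \<open>norm b\<close>, so the ball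
    enlarged by \<open>norm b\<close> contains the supports of all the quotients.\<close>
  have s_bound: "\<bar>s n x\<bar> \<le> M * indicator (cball a (r + norm b)) x" for n x
  proof (cases "x \<in> cball a (r + norm b)")
    case True
    have "norm (g (x + (1 / Suc n) *\<^sub>R b) - g (x + 0 *\<^sub>R b)) \<le> M * norm (1 / real (Suc n) - 0)"
      by (rule field_differentiable_bound[OF convex_UNIV])
        (use line bd in \<open>auto intro: has_field_derivative_at_within\<close>)
    then have "real (Suc n) * \<bar>g (x + (1 / Suc n) *\<^sub>R b) - g x\<bar> \<le> real (Suc n) * (M * (1 / Suc n))"
      by (intro mult_left_mono) auto
    then show ?thesis using True
      by (simp add: s_def abs_mult del: of_nat_Suc)
  next
    case False
    have "norm ((1 / Suc n) *\<^sub>R b) \<le> norm b"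
      by (simp add: field_simps)
    moreover have "dist a x \<le> dist a (x + (1 / Suc n) *\<^sub>R b) + norm ((1 / Suc n) *\<^sub>R b)"
      using dist_triangle[of a x "x + (1 / Suc n) *\<^sub>R b"] by (simp add: dist_norm)
    ultimately have "x + (1 / Suc n) *\<^sub>R b \<notin> cball a r" "x \<notin> cball a r"
      using False norm_ge_zero[of b] unfolding mem_cball by linarith+
    then show ?thesis by (simp add: s_def supp M)
  qed
  have s_lim: "(\<lambda>n. s n x) \<longlonglongrightarrow> D x \<bullet> b" for x
  proof -
    have "((\<lambda>h. (g (x + h *\<^sub>R b) - g x) / h) \<longlongrightarrow> D x \<bullet> b) (at 0)"
      using line[of x 0] by (simp add: has_field_derivative_iff)
    moreover have "filterlim (\<lambda>n. 1 / real (Suc n)) (at 0) sequentially"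
      unfolding filterlim_at using LIMSEQ_Suc[OF lim_1_over_n] by auto
    ultimately have "((\<lambda>n. (g (x + (1 / real (Suc n)) *\<^sub>R b) - g x) / (1 / real (Suc n))) \<longlongrightarrow> D x \<bullet> b) sequentially"
      by (rule filterlim_compose)
    then show ?thesis by (simp add: s_def mult.commute)
  qed
  have s_meas[measurable]: "s n \<in> borel_measurable lborel" for n
    unfolding s_def by measurable
  have D_meas: "(\<lambda>x. D x \<bullet> b) \<in> borel_measurable lborel"
    by (rule borel_measurable_LIMSEQ_real[OF _ s_meas]) (use s_lim in auto)
  have w: "integrable lborel (\<lambda>x. M * indicator (cball a (r + norm b)) x)"
    using emeasure_bounded_finite[OF bounded_cball, of a "r + norm b"]
    by (intro integrable_mult_right integrable_real_indicator) (auto simp: top.not_eq_extremum)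
  have g_int: "integrable lborel g"
  proof -
    have "integrable lborel (\<lambda>x. indicator (cball a r) x *\<^sub>R g x)"
      by (rule borel_integrable_compact) (auto intro: continuous_on_subset[OF cont])
    also have "(\<lambda>x. indicator (cball a r) x *\<^sub>R g x) = g"
      using supp by (auto simp: indicator_def fun_eq_iff)
    finally show ?thesis .
  qed
  have "integrable lborel (\<lambda>x. g (x + c)) \<and> (LINT x|lborel. g (x + c)) = (LINT x|lborel. g x)" for c
  proof -
    have "integrable (distr lborel borel ((+) c)) g" by (simp add: lborel_distr_plus g_int)
    moreover have "(LINT x|distr lborel borel ((+) c). g x) = (LINT x|lborel. g x)"
      by (simp add: lborel_distr_plus)
    ultimately show ?thesis
      by (subst (asm) integral_distr, simp, simp, subst (asm) integrable_distr_eq, simp, simp)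
        (simp add: add.commute)
  qed
  then have s_int: "(LINT x|lborel. s n x) = 0" for n
    unfolding s_def by (simp add: g_int)
  show "integrable lborel (\<lambda>x. D x \<bullet> b)"
    by (rule integrable_dominated_convergence[where s = s, OF D_meas s_meas w])
      (use s_lim s_bound in auto)
  have "(\<lambda>n. LINT x|lborel. s n x) \<longlonglongrightarrow> (LINT x|lborel. D x \<bullet> b)"
    by (rule integral_dominated_convergence[where s = s, OF D_meas s_meas w])
      (use s_lim s_bound in auto)
  then show "(LINT x|lborel. D x \<bullet> b) = 0"
    by (simp add: s_int LIMSEQ_const_iff)
qed

section \<open>The pointwise equation\<close>

lemma sum_hess_inner_Basis:
  "(\<Sum>b\<in>Basis. (hess u x b \<bullet> v) * (v \<bullet> b)) = hess u x v \<bullet> v"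
proof -
  have "hess u x v = (\<Sum>b\<in>Basis. (v \<bullet> b) *\<^sub>R hess u x b)"
    using linear_sum[OF linear_hess, of u x "\<lambda>b. (v \<bullet> b) *\<^sub>R b" Basis]
    by (simp add: euclidean_representation linear_cmul[OF linear_hess])
  then show ?thesis by (simp add: inner_sum_left mult.commute)
qed

text \<open>The product rule for |g|^(p-2) g with g = \<open>grad u x\<close>: the norm has
  derivative (Hess u h . g) / |g|, and the powers of |g| collect to p - 4.\<close>

definition p_flux_deriv :: "real \<Rightarrow> ('a::euclidean_space \<Rightarrow> real) \<Rightarrow> 'a \<Rightarrow> 'a \<Rightarrow> 'a" where
  "p_flux_deriv p u x h = (norm (grad u x) powr (p - 2)) *\<^sub>R hess u x h
     + ((p - 2) * norm (grad u x) powr (p - 4) * (hess u x h \<bullet> grad u x)) *\<^sub>R grad u x"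

lemma has_derivative_p_flux:
  assumes "Ck_on 2 u S" "x \<in> S" "grad u x \<noteq> 0"
  shows "(p_flux p u has_derivative p_flux_deriv p u x) (at x)"
proof -
  let ?g = "grad u x"
  have n: "norm ?g > 0" using assms by simp
  have g: "(grad u has_derivative hess u x) (at x)"
    by (rule has_derivative_grad_hess[OF assms(1,2)])
  have "((\<lambda>x. norm (grad u x)) has_derivative (\<lambda>h. hess u x h \<bullet> sgn ?g)) (at x)"
    by (rule has_derivative_compose[OF g has_derivative_norm]) (use assms in auto)
  from has_derivative_powr[OF this has_derivative_const[of "p - 2"] n]
  have "((\<lambda>x. norm (grad u x) powr (p - 2)) has_derivative
    (\<lambda>h. norm ?g powr (p - 2) * ((hess u x h \<bullet> sgn ?g) * (p - 2) / norm ?g))) (at x)"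
    by simp
  from has_derivative_scaleR[OF this g]
  show ?thesis
    unfolding p_flux_def[abs_def]
  proof (rule has_derivative_eq_rhs, intro ext)
    fix h
    have "norm ?g powr (p - 2) = norm ?g powr (p - 4) * (norm ?g)\<^sup>2"
      using n powr_add[of "norm ?g" "p - 4" 2] by simp
    then have "norm ?g powr (p - 2) * ((hess u x h \<bullet> sgn ?g) * (p - 2) / norm ?g) =
        (p - 2) * norm ?g powr (p - 4) * (hess u x h \<bullet> ?g)"
      using n by (simp add: sgn_div_norm power2_eq_square)
    then show "(norm ?g powr (p - 2)) *\<^sub>R hess u x h +
      (norm ?g powr (p - 2) * ((hess u x h \<bullet> sgn ?g) * (p - 2) / norm ?g)) *\<^sub>R ?g = p_flux_deriv p u x h"
      by (simp only: p_flux_deriv_def)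
  qed
qed

text \<open>The divergence of the flux, with |g|^(p-2) factored out; what remains is the normalised
  p-Laplacian. The rank-one part of the derivative contributes the quadratic form of the Hessian at
  g, that is |g|^2 times its value at the unit vector \<open>n\<close>.\<close>

lemma sum_p_flux_deriv:
  fixes u :: "'a::euclidean_space \<Rightarrow> real"
  assumes "grad u x \<noteq> 0"
  defines "n \<equiv> sgn (grad u x)"
  shows "(\<Sum>b\<in>Basis. p_flux_deriv p u x b \<bullet> b) =
    norm (grad u x) powr (p - 2) * ((\<Sum>b\<in>Basis. hess u x b \<bullet> b) + (p - 2) * (hess u x n \<bullet> n))"
proof -
  let ?g = "grad u x"
  have n: "norm ?g > 0" using assms by simp
  have "(\<Sum>b\<in>Basis. p_flux_deriv p u x b \<bullet> b) =
      norm ?g powr (p - 2) * (\<Sum>b\<in>Basis. hess u x b \<bullet> b)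
      + (p - 2) * norm ?g powr (p - 4) * (hess u x ?g \<bullet> ?g)"
    unfolding sum_hess_inner_Basis[of u x ?g, symmetric]
    by (simp add: p_flux_deriv_def inner_add_left sum.distrib sum_distrib_left mult.assoc)
  moreover have "norm ?g powr (p - 4) * (hess u x ?g \<bullet> ?g) = norm ?g powr (p - 2) * (hess u x n \<bullet> n)"
  proof -
    have "?g = norm ?g *\<^sub>R n" using n by (simp add: n_def sgn_div_norm)
    then have "hess u x ?g \<bullet> ?g = (norm ?g)\<^sup>2 * (hess u x n \<bullet> n)"
      by (metis (no_types, lifting) inner_scaleR_left inner_scaleR_right linear_cmul[OF linear_hess] mult.assoc power2_eq_square)
    moreover have "norm ?g powr (p - 2) = norm ?g powr (p - 4) * (norm ?g)\<^sup>2"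
      using n powr_add[of "norm ?g" "p - 4" 2] by simp
    ultimately show ?thesis by simp
  qed
  ultimately show ?thesis by (simp add: algebra_simps)
qed

text \<open>Where the gradient does not vanish the flux is differentiable with continuous
  derivative, so the weak form can be integrated by parts. The residual \<open>E\<close> is
  continuous; were it nonzero at \<open>x0\<close>, a bump supported where \<open>E\<close> keeps
  its sign would contradict the weak equation. Dividing by |grad u|^(p-2) gives the stated
  form.\<close>

lemma pde_pointwise:
  fixes u :: "'a::euclidean_space \<Rightarrow> real"
  assumes \<Omega>: "open \<Omega>" and u: "Ck_on 2 u \<Omega>" and sol: "distributional_solution p q \<Omega> u"
    and x0: "x0 \<in> \<Omega>" "grad u x0 \<noteq> 0"
  defines "n \<equiv> sgn (grad u x0)"
  shows "(\<Sum>b\<in>Basis. hess u x0 b \<bullet> b) + (p - 2) * (hess u x0 n \<bullet> n) = norm (grad u x0) powr (q - p + 2)"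
proof -
  define U where "U = {x\<in>\<Omega>. grad u x \<noteq> 0}"
  have "U = \<Omega> \<inter> grad u -` (- {0})" by (auto simp: U_def)
  then have U: "open U"
    using continuous_open_preimage[OF continuous_on_grad[OF u] \<Omega> open_Compl[OF closed_singleton]]
    by simp
  have U\<Omega>: "U \<subseteq> \<Omega>" and nz: "\<And>x. x \<in> U \<Longrightarrow> grad u x \<noteq> 0" by (auto simp: U_def)
  define dv where "dv x = (\<Sum>b\<in>Basis. p_flux_deriv p u x b \<bullet> b)" for x
  define E where "E x = dv x - norm (grad u x) powr q" for x
  note cg = continuous_on_subset[OF continuous_on_grad[OF u] U\<Omega>]
  note ch = continuous_on_subset[OF continuous_on_hess[OF u] U\<Omega>]
  have cpow: "continuous_on U (\<lambda>x. norm (grad u x) powr a)" for a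
    using nz by (intro continuous_intros cg) auto
  have cd: "continuous_on U (\<lambda>x. p_flux_deriv p u x b)" for b
    unfolding p_flux_deriv_def by (intro continuous_intros cpow cg ch)
  have cf: "continuous_on U (p_flux p u)"
    unfolding p_flux_def[abs_def] by (intro continuous_intros cpow cg)
  have cdv: "continuous_on U dv"
    unfolding dv_def[abs_def] by (intro continuous_intros cd)
  have cE: "continuous_on U E"
    unfolding E_def[abs_def] by (intro continuous_intros cpow cdv)
  have "E x0 = 0"
  proof (rule ccontr)
    assume E0: "E x0 \<noteq> 0"
    \<comment> \<open>The points of \<open>U\<close> where \<open>E\<close> has the same strict sign
      as at \<open>x0\<close>; multiplying by \<open>E x0\<close> treats both signs
      together.\<close>
    define V where "V = U \<inter> (\<lambda>x. E x * E x0) -` {0<..}"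
    have "open V"
      unfolding V_def
      by (rule continuous_open_preimage) (auto intro!: continuous_intros cE U)
    moreover have "x0 \<in> V" using x0 E0 by (auto simp: V_def U_def zero_less_mult_iff)
    ultimately obtain r where r: "r > 0" "cball x0 r \<subseteq> V"
      using open_contains_cball by metis
    define K where "K = cball x0 r"
    have K: "compact K" "K \<subseteq> U" "K \<subseteq> \<Omega>" using r U\<Omega> by (auto simp: K_def V_def)
    obtain \<phi> where \<phi>: "test_function \<Omega> \<phi>" "\<And>x. \<phi> x \<ge> 0" "\<And>x. \<phi> x > 0 \<longleftrightarrow> x \<in> ball x0 r"
      using bump_exists[of r x0 \<Omega>] r K by (auto simp: K_def)
    have \<phi>0: "\<phi> x = 0" if "x \<notin> K" for x
      using that \<phi>(2)[of x] \<phi>(3)[of x] by (auto simp: K_def)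
    have \<phi>2: "Ck_on 2 \<phi> UNIV" using \<phi>(1) by (simp add: test_function_def)
    note d\<phi> = has_derivative_grad[OF C2_differentiable(1)[OF \<phi>2 UNIV_I]]
    note c\<phi> = continuous_on_C2[OF \<phi>2, THEN continuous_on_subset, OF subset_UNIV]
    note cg\<phi> = continuous_on_grad[OF \<phi>2, THEN continuous_on_subset, OF subset_UNIV]
    have zero_near: "(f has_derivative (\<lambda>h. 0 \<bullet> h)) (at x)"
      if "x \<notin> K" "\<And>y. y \<notin> K \<Longrightarrow> f y = (0::real)" for f :: "'a \<Rightarrow> real" and x
    proof -
      have "((\<lambda>_. 0) has_derivative (\<lambda>h. 0 \<bullet> h)) (at x)" by simp
      then show ?thesis
        by (rule has_derivative_transform_within_open[of _ _ _ _ "- K"])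
          (use that K(1) in \<open>auto intro: compact_imp_closed\<close>)
    qed
    have g\<phi>0: "grad \<phi> x = 0" if "x \<notin> K" for x
      by (rule grad_unique[OF zero_near[OF that \<phi>0]])
    \<comment> \<open>The gradient of the \<open>b\<close>-th flux component times
      \<open>\<phi>\<close>. The cut to \<open>K\<close> makes it meaningful also where
      \<open>grad u\<close> vanishes, since the product is zero off \<open>K\<close>.\<close>
    define G where "G b x = indicator K x *\<^sub>R
       (\<phi> x *\<^sub>R grad (\<lambda>x. p_flux p u x \<bullet> b) x + (p_flux p u x \<bullet> b) *\<^sub>R grad \<phi> x)" for b x
    have der_comp: "((\<lambda>x. p_flux p u x \<bullet> b) has_derivative (\<lambda>h. p_flux_deriv p u x h \<bullet> b)) (at x)" if "x \<in> U" for b x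
      by (rule has_derivative_inner_left[OF has_derivative_p_flux[OF u]])
        (use that U\<Omega> nz in auto)
    have grad_comp: "grad (\<lambda>x. p_flux p u x \<bullet> b) x \<bullet> h = p_flux_deriv p u x h \<bullet> b" if "x \<in> U" for b x h
    proof -
      have "(\<lambda>x. p_flux p u x \<bullet> b) differentiable (at x)"
        using der_comp[OF that] by (auto simp: differentiable_def)
      from has_derivative_unique[OF has_derivative_grad[OF this] der_comp[OF that]]
      show ?thesis by (rule fun_cong)
    qed
    have G: "((\<lambda>x. (p_flux p u x \<bullet> b) * \<phi> x) has_derivative (\<lambda>h. G b x \<bullet> h)) (at x)" for b x
    proof (cases "x \<in> K")
      case True
      then have "x \<in> U" using K by auto
      from has_derivative_mult[OF der_comp[OF this, of b] d\<phi>[of x]]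
      show ?thesis
        by (rule has_derivative_eq_rhs)
          (use True grad_comp[OF \<open>x \<in> U\<close>] in \<open>auto simp: G_def inner_add_left algebra_simps\<close>)
    next
      case False
      then show ?thesis
        using zero_near[OF False, of "\<lambda>x. (p_flux p u x \<bullet> b) * \<phi> x"] \<phi>0 by (simp add: G_def)
    qed
    have Gb: "G b x \<bullet> b = indicator K x *\<^sub>R (\<phi> x * (p_flux_deriv p u x b \<bullet> b))
        + indicator K x *\<^sub>R ((p_flux p u x \<bullet> b) * (grad \<phi> x \<bullet> b))" for b x
      using grad_comp[of x b b] K by (auto simp: G_def indicator_def inner_add_left)
    have int: "integrable lborel (\<lambda>x. indicator K x *\<^sub>R f x)" if "continuous_on U f" for f :: "'a \<Rightarrow> real"
      by (rule borel_integrable_compact[OF K(1) continuous_on_subset[OF that K(2)]])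
    have zero: "(LINT x|lborel. G b x \<bullet> b) = 0" for b
    proof -
      have "continuous_on U (\<lambda>x. \<phi> x * (p_flux_deriv p u x b \<bullet> b) + (p_flux p u x \<bullet> b) * (grad \<phi> x \<bullet> b))"
        by (intro continuous_intros c\<phi> cd cf cg\<phi>)
      then have "bounded ((\<lambda>x. \<phi> x * (p_flux_deriv p u x b \<bullet> b) + (p_flux p u x \<bullet> b) * (grad \<phi> x \<bullet> b)) ` K)"
        using K by (intro compact_imp_bounded compact_continuous_image) (auto intro: continuous_on_subset)
      then obtain M where M: "M > 0" "\<And>x. x \<in> K \<Longrightarrow>
         \<bar>\<phi> x * (p_flux_deriv p u x b \<bullet> b) + (p_flux p u x \<bullet> b) * (grad \<phi> x \<bullet> b)\<bar> \<le> M"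
        by (auto simp: bounded_pos)
      show ?thesis
      proof (rule integral_partial_derivative_zero(2)[OF G])
        show "x \<notin> cball x0 r \<Longrightarrow> p_flux p u x \<bullet> b * \<phi> x = 0" for x
          using \<phi>0 by (simp add: K_def)
        show "\<bar>G b x \<bullet> b\<bar> \<le> M" for x
          using M by (auto simp: Gb indicator_def)
      qed
    qed
    have i1: "integrable lborel (\<lambda>x. indicator K x *\<^sub>R (\<phi> x * (p_flux_deriv p u x b \<bullet> b)))" for b
      by (intro int continuous_intros c\<phi> cd)
    have i2: "integrable lborel (\<lambda>x. indicator K x *\<^sub>R ((p_flux p u x \<bullet> b) * (grad \<phi> x \<bullet> b)))" for b
      by (intro int continuous_intros cf cg\<phi>)
    \<comment> \<open>Adding the vanishing integrals over all coordinates is the divergence theorem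
      for the compactly supported field \<open>\<phi>\<close> times the flux.\<close>
    have "0 = (\<Sum>b\<in>Basis. LINT x|lborel. G b x \<bullet> b)" by (simp add: zero)
    also have "\<dots> = (\<Sum>b\<in>Basis. LINT x|lborel. indicator K x *\<^sub>R (\<phi> x * (p_flux_deriv p u x b \<bullet> b)))
       + (\<Sum>b\<in>Basis. LINT x|lborel. indicator K x *\<^sub>R ((p_flux p u x \<bullet> b) * (grad \<phi> x \<bullet> b)))"
      unfolding Gb by (simp only: Bochner_Integration.integral_add[OF i1 i2] sum.distrib)
    also have "\<dots> = (LINT x|lborel. (\<Sum>b\<in>Basis. indicator K x *\<^sub>R (\<phi> x * (p_flux_deriv p u x b \<bullet> b))))
      + (LINT x|lborel. (\<Sum>b\<in>Basis. indicator K x *\<^sub>R ((p_flux p u x \<bullet> b) * (grad \<phi> x \<bullet> b))))"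
      by (simp only: Bochner_Integration.integral_sum[OF i1] Bochner_Integration.integral_sum[OF i2])
    also have "(\<lambda>x. \<Sum>b\<in>Basis. indicator K x *\<^sub>R (\<phi> x * (p_flux_deriv p u x b \<bullet> b))) = (\<lambda>x. indicator K x *\<^sub>R (\<phi> x * dv x))"
      by (simp add: dv_def scaleR_sum_right sum_distrib_left)
    also have "(\<lambda>x. \<Sum>b\<in>Basis. indicator K x *\<^sub>R ((p_flux p u x \<bullet> b) * (grad \<phi> x \<bullet> b))) =
        (\<lambda>x. indicator K x *\<^sub>R (p_flux p u x \<bullet> grad \<phi> x))"
      by (simp only: scaleR_sum_right[symmetric] euclidean_inner[symmetric])
    also have "(LINT x|lborel. indicator K x *\<^sub>R (p_flux p u x \<bullet> grad \<phi> x)) = (LINT x:\<Omega>|lborel. p_flux p u x \<bullet> grad \<phi> x)"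
      unfolding set_lebesgue_integral_def
      by (rule Bochner_Integration.integral_cong) (use g\<phi>0 K in \<open>auto simp: indicator_def\<close>)
    also have "\<dots> = - (LINT x:\<Omega>|lborel. norm (grad u x) powr q * \<phi> x)"
      using sol[unfolded distributional_solution_def, rule_format, OF \<phi>(1)] by linarith
    also have "(LINT x:\<Omega>|lborel. norm (grad u x) powr q * \<phi> x) = (LINT x|lborel. indicator K x *\<^sub>R (norm (grad u x) powr q * \<phi> x))"
      unfolding set_lebesgue_integral_def
      by (rule Bochner_Integration.integral_cong) (use \<phi>0 K in \<open>auto simp: indicator_def\<close>)
    finally have "(LINT x|lborel. indicator K x *\<^sub>R (\<phi> x * dv x)) = (LINT x|lborel. indicator K x *\<^sub>R (norm (grad u x) powr q * \<phi> x))"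
      by simp
    moreover have "integrable lborel (\<lambda>x. indicator K x *\<^sub>R (\<phi> x * dv x))"
      "integrable lborel (\<lambda>x. indicator K x *\<^sub>R (norm (grad u x) powr q * \<phi> x))"
      by (intro int continuous_intros c\<phi> cdv cpow)+
    ultimately have "(LINT x|lborel. indicator K x *\<^sub>R (\<phi> x * dv x) - indicator K x *\<^sub>R (norm (grad u x) powr q * \<phi> x)) = 0"
      by simp
    also have "(\<lambda>x. indicator K x *\<^sub>R (\<phi> x * dv x) - indicator K x *\<^sub>R (norm (grad u x) powr q * \<phi> x)) =
        (\<lambda>x. indicator K x *\<^sub>R (\<phi> x * E x))"
      by (auto simp: E_def indicator_def algebra_simps fun_eq_iff)
    finally have "(LINT x|lborel. (indicator K x *\<^sub>R (\<phi> x * E x)) * E x0) = 0"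
      by simp
    moreover have "integrable lborel (\<lambda>x. (indicator K x *\<^sub>R (\<phi> x * E x)) * E x0)"
      by (intro integrable_mult_left int continuous_intros c\<phi> cE)
    moreover have Epos: "E x * E x0 > 0" if "x \<in> K" for x
      using r(2) that by (auto simp: K_def V_def)
    then have "(indicator K x *\<^sub>R (\<phi> x * E x)) * E x0 \<ge> 0" for x
      using \<phi>(2)[of x] Epos[of x] by (auto simp: indicator_def mult.assoc less_imp_le)
    ultimately have "AE x in lborel. (indicator K x *\<^sub>R (\<phi> x * E x)) * E x0 = 0"
      by (subst (asm) integral_nonneg_eq_0_iff_AE) auto
    then have "AE x in lborel. x \<notin> ball x0 r"
    proof (rule AE_mp, intro AE_I2 impI notI)
      fix x assume "x \<in> ball x0 r" and *: "(indicator K x *\<^sub>R (\<phi> x * E x)) * E x0 = 0"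
      then have "x \<in> K" "\<phi> x > 0" using \<phi>(3)[of x] by (auto simp: K_def)
      then show False using Epos[of x] * by (auto simp: indicator_def)
    qed
    then have "ball x0 r \<in> null_sets lborel"
      by (subst (asm) AE_iff_null_sets[symmetric]) auto
    then have "negligible (ball x0 r)"
      by (simp add: negligible_iff_null_sets null_sets_completionI)
    then show False using r(1) open_not_negligible[of "ball x0 r"] by auto
  qed
  then have "norm (grad u x0) powr (p - 2) * ((\<Sum>b\<in>Basis. hess u x0 b \<bullet> b) + (p - 2) * (hess u x0 n \<bullet> n)) = norm (grad u x0) powr q"
    using sum_p_flux_deriv[OF x0(2), of p] by (simp add: E_def dv_def n_def)
  also have "\<dots> = norm (grad u x0) powr (p - 2) * norm (grad u x0) powr (q - p + 2)"
    by (simp add: powr_add[symmetric])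
  finally show ?thesis using x0(2) by simp
qed

section \<open>The gradient estimate by doubling of variables\<close>

text \<open>The chord of the convex function x^s over the interval from 1 to 2.\<close>

lemma one_plus_powr_le:
  fixes t s :: real
  assumes "0 \<le> t" "t \<le> 1" "s \<ge> 1"
  shows "(1 + t) powr s \<le> 1 + 2 powr s * t"
proof -
  have "(\<lambda>x. x powr s) ((1 - t) *\<^sub>R 1 + t *\<^sub>R 2) \<le> (1 - t) * 1 powr s + t * 2 powr s"
    using convex_onD[OF powr_convex[OF assms(3)], of t 1 2] assms by simp
  also have "(1 - t) *\<^sub>R 1 + t *\<^sub>R 2 = 1 + t" by simp
  finally show ?thesis using assms by (simp add: algebra_simps)
qed

text \<open>After multiplication by \<open>norm w\<close>, passing to unit vectors costs
  \<open>norm (v - w)\<close> once more. It turns closeness of the gradients at the two doubled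
  points into closeness of their directions.\<close>

lemma norm_sgn_diff_le:
  fixes v w :: "'a::real_normed_vector"
  assumes "w \<noteq> 0" "v \<noteq> 0"
  shows "norm (sgn v - sgn w) \<le> 2 * norm (v - w) / norm w"
proof -
  have "norm w *\<^sub>R (sgn v - sgn w) = (norm w - norm v) *\<^sub>R sgn v + (v - w)"
    using assms by (simp add: sgn_div_norm algebra_simps)
  then have "norm w * norm (sgn v - sgn w) \<le> \<bar>norm w - norm v\<bar> * norm (sgn v) + norm (v - w)"
    by (metis abs_norm_cancel norm_scaleR norm_triangle_ineq)
  also have "\<dots> \<le> 2 * norm (v - w)"
    using assms norm_triangle_ineq3[of w v] by (simp add: norm_sgn norm_minus_commute)
  finally show ?thesis using assms by (simp add: field_simps)
qed

text \<open>\<open>stretch k n\<close> is the square root of \<open>1 + (k\<^sup>2 - 1) n \<otimes> n\<close>, the coefficient matrix of the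
  normalised \<open>p\<close>-Laplacian with \<open>k\<^sup>2 = p - 1\<close>.\<close>

definition stretch :: "real \<Rightarrow> 'a::euclidean_space \<Rightarrow> 'a \<Rightarrow> 'a" where
  "stretch k n b = b + ((k - 1) * (n \<bullet> b)) *\<^sub>R n"

text \<open>With S = \<open>stretch k n\<close> symmetric and S^2 = 1 + (k^2 - 1) n n^T, the left
  side is trace(S X S) = trace(S^2 X). The operator thereby becomes a sum of quadratic forms in
  single directions, the shape in which the second order condition at the maximum is
  available.\<close>

lemma trace_stretch:
  fixes X :: "'a::euclidean_space \<Rightarrow> 'a"
  assumes X: "linear X" and n: "norm n = 1"
  shows "(\<Sum>b\<in>Basis. X (stretch k n b) \<bullet> stretch k n b)
    = (\<Sum>b\<in>Basis. X b \<bullet> b) + (k\<^sup>2 - 1) * (X n \<bullet> n)"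
proof -
  have nn: "(\<Sum>b\<in>Basis. (n \<bullet> b) * (n \<bullet> b)) = 1"
    using n by (simp add: euclidean_inner[symmetric] norm_eq_1)
  have 1: "(\<Sum>b\<in>Basis. (n \<bullet> b) * (X n \<bullet> b)) = X n \<bullet> n"
    by (subst euclidean_inner[of "X n" n]) (simp add: mult.commute)
  have "n = (\<Sum>b\<in>Basis. (n \<bullet> b) *\<^sub>R b)" by (simp add: euclidean_representation)
  then have "X n = (\<Sum>b\<in>Basis. (n \<bullet> b) *\<^sub>R X b)"
    using linear_sum[OF X, of "\<lambda>b. (n \<bullet> b) *\<^sub>R b" Basis] by (simp add: linear_cmul[OF X])
  then have 2: "(\<Sum>b\<in>Basis. (n \<bullet> b) * (X b \<bullet> n)) = X n \<bullet> n"
    by (simp add: inner_sum_left)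
  have expand: "X (b + c *\<^sub>R n) \<bullet> (b + c *\<^sub>R n) = X b \<bullet> b + c * (X b \<bullet> n) + c * (X n \<bullet> b) + c\<^sup>2 * (X n \<bullet> n)" for b c
    by (simp add: linear_add[OF X] linear_cmul[OF X] inner_add_left inner_add_right power2_eq_square algebra_simps)
  have "(\<Sum>b\<in>Basis. X (stretch k n b) \<bullet> stretch k n b) =
    (\<Sum>b\<in>Basis. X b \<bullet> b + (k - 1) * ((n \<bullet> b) * (X b \<bullet> n)) + (k - 1) * ((n \<bullet> b) * (X n \<bullet> b))
       + (k - 1)\<^sup>2 * (X n \<bullet> n) * ((n \<bullet> b) * (n \<bullet> b)))"
    unfolding stretch_def expand by (simp add: power_mult_distrib power2_eq_square ac_simps)
  also have "\<dots> = (\<Sum>b\<in>Basis. X b \<bullet> b) + (k - 1) * (X n \<bullet> n) + (k - 1) * (X n \<bullet> n) + (k - 1)\<^sup>2 * (X n \<bullet> n)"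
    by (simp only: sum.distrib sum_distrib_left[symmetric] nn 1 2 mult_1_right)
  finally show ?thesis by (simp add: power2_eq_square algebra_simps)
qed

lemma norm_stretch_le:
  assumes "norm n = 1" "b \<in> Basis"
  shows "norm (stretch k n b) \<le> 1 + \<bar>k - 1\<bar>"
proof -
  have "\<bar>n \<bullet> b\<bar> \<le> 1" using assms Cauchy_Schwarz_ineq2[of n b] by simp
  then have "norm (((k - 1) * (n \<bullet> b)) *\<^sub>R n) \<le> \<bar>k - 1\<bar>"
    using assms by (simp add: abs_mult mult_left_le)
  then show ?thesis
    using norm_triangle_ineq[of b "((k - 1) * (n \<bullet> b)) *\<^sub>R n"] assms by (simp add: stretch_def)
qed

text \<open>Lipschitz dependence of the square root on the direction: this is the price of the
  different coefficient matrices at the two points.\<close>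

lemma norm_stretch_diff_le:
  assumes "norm n = 1" "norm m = 1" "b \<in> Basis"
  shows "norm (stretch k n b - stretch k m b) \<le> 2 * \<bar>k - 1\<bar> * norm (n - m)"
proof -
  have "stretch k n b - stretch k m b = (k - 1) *\<^sub>R ((n \<bullet> b) *\<^sub>R (n - m) + ((n - m) \<bullet> b) *\<^sub>R m)"
    by (simp add: stretch_def algebra_simps inner_diff_left)
  also have "norm \<dots> \<le> \<bar>k - 1\<bar> * (\<bar>n \<bullet> b\<bar> * norm (n - m) + \<bar>(n - m) \<bullet> b\<bar> * norm m)"
    by (auto intro!: mult_left_mono norm_triangle_le)
  also have "\<dots> \<le> \<bar>k - 1\<bar> * (1 * norm (n - m) + norm (n - m) * norm m)"
    using Cauchy_Schwarz_ineq2[of n b] Cauchy_Schwarz_ineq2[of "n - m" b] assms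
    by (intro mult_left_mono add_mono mult_right_mono) auto
  finally show ?thesis using assms by simp
qed

section \<open>The penalty along a line and its second derivative\<close>

lemma DERIV_quotient_power:
  fixes g r :: "real \<Rightarrow> real"
  assumes g: "(g has_real_derivative g') (at t)" and r: "(r has_real_derivative r') (at t)" and nz: "r t \<noteq> 0"
  shows "((\<lambda>t. g t / r t ^ n) has_real_derivative (g' * r t - n * g t * r') / r t ^ Suc n) (at t)"
proof -
  have "n * (r' * r t ^ (n - Suc 0)) * r t = n * r' * r t ^ n"
    by (cases n) auto
  then show ?thesis
    using nz by (intro DERIV_cong[OF DERIV_divide[OF g DERIV_power[OF r, of n]]])
      (auto simp: divide_simps, simp add: algebra_simps)
qed

text \<open>Derivatives along a line of the penalty \<open>|y - x|\<^sup>2 / (2 \<epsilon> \<rho>\<^sup>m)\<close>, where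
  \<open>\<rho> = r0 + a t - c t\<^sup>2\<close> and \<open>|y - x|\<^sup>2 = g0 + g1 t + g2 t\<^sup>2\<close>.\<close>

lemma penalty_derivatives:
  fixes r0 a c g0 g1 g2 \<epsilon> :: real and m :: nat and r g Q' :: "real \<Rightarrow> real"
  assumes r0: "r0 > 0" and \<epsilon>: "\<epsilon> > 0"
  defines "r \<equiv> \<lambda>t. r0 + a * t - c * t\<^sup>2" and "g \<equiv> \<lambda>t. g0 + g1 * t + g2 * t\<^sup>2"
  defines "Q' \<equiv> \<lambda>t. ((g1 + 2 * g2 * t) * r t - m * g t * (a - 2 * c * t)) / r t ^ Suc m / (2 * \<epsilon>)"
  shows "r t \<noteq> 0 \<Longrightarrow> ((\<lambda>t. g t / r t ^ m / (2 * \<epsilon>)) has_real_derivative Q' t) (at t)"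
    and "(Q' has_real_derivative
      (2 * g2 * r0\<^sup>2 - 2 * real m * g1 * a * r0 + 2 * real m * g0 * c * r0 + real m * (real m + 1) * g0 * a\<^sup>2)
        / r0 ^ (m + 2) / (2 * \<epsilon>)) (at 0)"
proof -
  have r: "(r has_real_derivative a - 2 * c * t) (at t)" for t
    unfolding r_def by (auto intro!: derivative_eq_intros)
  have g: "(g has_real_derivative g1 + 2 * g2 * t) (at t)" for t
    unfolding g_def by (auto intro!: derivative_eq_intros)
  show "r t \<noteq> 0 \<Longrightarrow> ((\<lambda>t. g t / r t ^ m / (2 * \<epsilon>)) has_real_derivative Q' t) (at t)"
    unfolding Q'_def by (intro DERIV_cdivide DERIV_quotient_power g r)
  have r00: "r 0 = r0" "g 0 = g0" by (auto simp: r_def g_def)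
  have num: "((\<lambda>t. (g1 + 2 * g2 * t) * r t - m * g t * (a - 2 * c * t)) has_real_derivative
      2 * g2 * r0 + g1 * a - m * (g1 * a - 2 * c * g0)) (at 0)"
    by (rule derivative_eq_intros r g refl)+ (simp add: r00 algebra_simps)
  from DERIV_cdivide[OF DERIV_quotient_power[OF num r, of "Suc m"], of "2 * \<epsilon>"] r0
  show "(Q' has_real_derivative
      (2 * g2 * r0\<^sup>2 - 2 * real m * g1 * a * r0 + 2 * real m * g0 * c * r0 + real m * (real m + 1) * g0 * a\<^sup>2)
        / r0 ^ (m + 2) / (2 * \<epsilon>)) (at 0)"
    unfolding Q'_def
    by (rule_tac DERIV_cong) (auto simp: r00 power2_eq_square algebra_simps)
qed

text \<open>Here \<open>\<xi>\<close> and \<open>\<sigma>\<close> stand for the norms of the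
  direction at x and of the difference of directions, and \<open>\<epsilon> * r0 ^ m * P\<close> for
  |y - x|. The hypotheses on \<open>a\<close> and \<open>g1\<close> are Cauchy-Schwarz bounds; the
  mixed term is split by Young's inequality.\<close>

lemma penalty_second_derivative_le:
  fixes r0 a c g0 g1 g2 \<epsilon> P R \<xi> \<sigma> :: real and j :: nat
  defines "m \<equiv> j + 2"
  assumes r0: "r0 > 0" "r0 \<le> R\<^sup>2" and \<epsilon>: "\<epsilon> > 0" and R: "R > 0" and P: "P \<ge> 0" and s: "\<xi> \<ge> 0" "\<sigma> \<ge> 0"
    and a: "\<bar>a\<bar> \<le> 2 * R * \<xi>" and c: "c = \<xi>\<^sup>2" and g0: "g0 = (\<epsilon> * r0 ^ m * P)\<^sup>2"
    and g1: "\<bar>g1\<bar> \<le> 2 * (\<epsilon> * r0 ^ m * P) * \<sigma>" and g2: "g2 = \<sigma>\<^sup>2"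
  shows "(2 * g2 * r0\<^sup>2 - 2 * real m * g1 * a * r0 + 2 * real m * g0 * c * r0 + real m * (real m + 1) * g0 * a\<^sup>2)
        / r0 ^ (m + 2) / (2 * \<epsilon>)
     \<le> 2 * \<sigma>\<^sup>2 / (\<epsilon> * r0 ^ m) + \<epsilon> * (6 * (real m)\<^sup>2 + 3 * real m) * P\<^sup>2 * r0 ^ j * R\<^sup>2 * \<xi>\<^sup>2"
proof -
  let ?z = "r0 ^ j"
  have rm: "r0 ^ m = ?z * r0\<^sup>2" by (simp add: m_def power_add power2_eq_square)
  have z: "?z > 0" using r0 by simp
  \<comment> \<open>Chosen so that \<open>(A * r0)\<^sup>2 = g0 * \<xi>\<^sup>2 * R\<^sup>2\<close>,
    the common unit in which all terms not involving \<open>\<sigma>\<close> are measured.\<close>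
  define A where "A = \<epsilon> * P * ?z * r0 * \<xi> * R"
  have t1: "- (2 * real m * g1 * a * r0) \<le> 2 * m * (2 * (\<epsilon> * r0 ^ m * P) * \<sigma> * (2 * R * \<xi>)) * r0"
  proof -
    have "- (g1 * a) \<le> \<bar>g1\<bar> * \<bar>a\<bar>" by (metis abs_ge_minus_self abs_mult)
    also have "\<dots> \<le> 2 * (\<epsilon> * r0 ^ m * P) * \<sigma> * (2 * R * \<xi>)"
      by (rule mult_mono[OF g1 a]) (use \<epsilon> r0 P s in auto)
    finally have "(2 * m * r0) * - (g1 * a) \<le> (2 * m * r0) * (2 * (\<epsilon> * r0 ^ m * P) * \<sigma> * (2 * R * \<xi>))"
      by (rule mult_left_mono) (use r0 in auto)
    then show ?thesis by (simp add: algebra_simps)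
  qed
  have "2 * m * (2 * (\<epsilon> * r0 ^ m * P) * \<sigma> * (2 * R * \<xi>)) * r0 = 2 * (\<sigma> * r0) * (4 * m * A * r0)"
    by (simp add: A_def rm power2_eq_square)
  \<comment> \<open>Young's inequality doubles the square of \<open>\<sigma> * r0\<close> already
    present and leaves 8 m^2; with 2 m and 4 m (m + 1) from the other two terms this adds up to 12
    m^2 + 6 m.\<close>
  also have "\<dots> \<le> 2 * (\<sigma> * r0)\<^sup>2 + 8 * (m * A * r0)\<^sup>2"
    using sum_squares_bound[of "\<sigma> * r0" "2 * m * A * r0"] by (simp add: power_mult_distrib algebra_simps)
  finally have t1': "- (2 * real m * g1 * a * r0) \<le> 2 * (\<sigma> * r0)\<^sup>2 + 8 * (m * A * r0)\<^sup>2"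
    by (rule order_trans[OF t1])
  have g0': "g0 * \<xi>\<^sup>2 * R\<^sup>2 = (A * r0)\<^sup>2"
    by (simp add: g0 rm A_def power_mult_distrib power2_eq_square algebra_simps)
  have t2: "2 * real m * g0 * c * r0 \<le> 2 * m * (A * r0)\<^sup>2"
  proof -
    have "(2 * m * g0 * \<xi>\<^sup>2) * r0 \<le> (2 * m * g0 * \<xi>\<^sup>2) * R\<^sup>2"
      by (rule mult_left_mono) (use r0 g0 in auto)
    also have "\<dots> = 2 * m * (g0 * \<xi>\<^sup>2 * R\<^sup>2)" by (simp only: ac_simps)
    also have "\<dots> = 2 * m * (A * r0)\<^sup>2" by (simp only: g0')
    finally show ?thesis by (simp only: c)
  qed
  have t3: "real m * (real m + 1) * g0 * a\<^sup>2 \<le> 4 * real m * (real m + 1) * (A * r0)\<^sup>2"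
  proof -
    have "a\<^sup>2 \<le> (2 * R * \<xi>)\<^sup>2" using a by (metis abs_le_square_iff abs_of_nonneg abs_ge_zero order_trans)
    then have "real m * (real m + 1) * g0 * a\<^sup>2 \<le> real m * (real m + 1) * g0 * (2 * R * \<xi>)\<^sup>2"
      by (intro mult_left_mono) (use g0 in auto)
    also have "\<dots> = 4 * real m * (real m + 1) * (g0 * \<xi>\<^sup>2 * R\<^sup>2)" by (simp add: power_mult_distrib)
    finally show ?thesis by (simp add: g0')
  qed
  have "2 * g2 * r0\<^sup>2 - 2 * real m * g1 * a * r0 + 2 * real m * g0 * c * r0 + real m * (real m + 1) * g0 * a\<^sup>2
     \<le> 4 * (\<sigma> * r0)\<^sup>2 + (12 * (real m)\<^sup>2 + 6 * real m) * (A * r0)\<^sup>2"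
    using t1' t2 t3 by (simp add: g2 power_mult_distrib power2_eq_square algebra_simps)
  also have "\<dots> = (2 * \<sigma>\<^sup>2 / (\<epsilon> * r0 ^ m) + \<epsilon> * (6 * (real m)\<^sup>2 + 3 * real m) * P\<^sup>2 * r0 ^ j * R\<^sup>2 * \<xi>\<^sup>2) * (r0 ^ (m + 2) * (2 * \<epsilon>))"
    using r0 \<epsilon> z by (simp add: A_def power_add rm field_simps) (simp add: eval_nat_numeral algebra_simps)
  finally have "2 * g2 * r0\<^sup>2 - 2 * real m * g1 * a * r0 + 2 * real m * g0 * c * r0 + real m * (real m + 1) * g0 * a\<^sup>2
     \<le> (2 * \<sigma>\<^sup>2 / (\<epsilon> * r0 ^ m) + \<epsilon> * (6 * (real m)\<^sup>2 + 3 * real m) * P\<^sup>2 * r0 ^ j * R\<^sup>2 * \<xi>\<^sup>2) * (r0 ^ (m + 2) * (2 * \<epsilon>))" .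
  moreover have "r0 ^ (m + 2) * (2 * \<epsilon>) > 0" using r0 \<epsilon> by simp
  ultimately show ?thesis
    by (simp only: divide_divide_eq_left pos_divide_le_eq)
qed

text \<open>This is 1 + A, where A dominates both coefficients of a quadratic inequality for r
  P^(s-1). The factor N (1 + |k - 1|)^2 bounds the sum of the squared lengths of the stretched basis
  vectors. In 70 m^2 + 3 m, 64 m^2 comes from the change of direction between the two points and 6
  m^2 + 3 m from the second derivative of the penalty.\<close>

definition doubling_const :: "nat \<Rightarrow> real \<Rightarrow> real \<Rightarrow> nat \<Rightarrow> real" where
  "doubling_const N k s m = 1 + 4 * (real N * (1 + \<bar>k - 1\<bar>)\<^sup>2) *
     (2 powr s * m + (real N * (1 + \<bar>k - 1\<bar>)\<^sup>2) * (70 * m\<^sup>2 + 3 * m))"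

lemma doubling_const_pos: "doubling_const N k s m > 0"
  unfolding doubling_const_def by (intro add_pos_nonneg mult_nonneg_nonneg add_nonneg_nonneg) auto

text \<open>The role of the term \<open>2|Hess u|\<^sup>2\<close> in Bernstein's method is played by the free factor \<open>1 + \<kappa>\<close>,
  \<open>\<kappa> = \<epsilon> \<kappa>0\<close>, in the directions chosen at \<open>y\<close>; optimising in \<open>\<kappa>0\<close> yields the square of
  \<open>P\<^sup>s\<close>.\<close>

lemma doubling_core_estimate:
  fixes X Y :: "'a::euclidean_space \<Rightarrow> 'a" and j :: nat
  defines "m \<equiv> j + 2"
  assumes lin: "linear X" "linear Y"
    and s: "s > 1" and P: "P > 0" and \<epsilon>: "\<epsilon> > 0" and r: "r > 0" and R: "R > 0"
    and gy: "gy = P *\<^sub>R n" "norm n = 1"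
    and \<Theta>: "\<Theta> = m * R * r ^ (j + 1) * P" and gx: "norm (gx - gy) \<le> \<epsilon> * \<Theta> * P" and small: "\<epsilon> * \<Theta> \<le> 1 / 2"
    and so: "\<And>\<tau> \<xi>. Y \<tau> \<bullet> \<tau> - X \<xi> \<bullet> \<xi> \<le>
        2 * (norm (\<tau> - \<xi>))\<^sup>2 / (\<epsilon> * r ^ m) + \<epsilon> * (6 * (real m)\<^sup>2 + 3 * real m) * P\<^sup>2 * r ^ j * R\<^sup>2 * (norm \<xi>)\<^sup>2"
    and py: "(\<Sum>b\<in>Basis. Y b \<bullet> b) + (k\<^sup>2 - 1) * (Y n \<bullet> n) = P powr s"
    and px: "(\<Sum>b\<in>Basis. X b \<bullet> b) + (k\<^sup>2 - 1) * (X (sgn gx) \<bullet> sgn gx) = norm gx powr s"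
  shows "r * P powr (s - 1) \<le> doubling_const DIM('a) k s m * R"
proof -
  define N where "N = real DIM('a)"
  define K where "K = 1 + \<bar>k - 1\<bar>"
  have N: "N \<ge> 1" by (simp add: N_def Suc_leI)
  have K: "K \<ge> 1" by (simp add: K_def)
  define D where "D = N * K\<^sup>2"
  have D: "D > 0" using N K by (simp add: D_def)
  define T where "T = P powr (s - 1)"
  have T: "T > 0" using P by (simp add: T_def)
  have PT: "P powr s = P * T" using P powr_add[of P 1 "s - 1"] by (simp add: T_def)
  have m: "m > 0" "r ^ m = r ^ j * r\<^sup>2" by (auto simp: m_def power_add power2_eq_square)
  have \<Theta>0: "\<Theta> \<ge> 0" using \<Theta> R r P by simp
  have ngy: "norm gy = P" "gy \<noteq> 0" "sgn gy = n" using gy P by (auto simp: sgn_div_norm)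
  define C :: real where "C = 6 * (real m)\<^sup>2 + 3 * real m"
  have C: "C \<ge> 0" by (simp add: C_def)
  define n' where "n' = sgn gx"
  have "norm (gx - gy) \<le> P / 2"
    using order_trans[OF gx mult_right_mono[OF small]] P by simp
  then have "gx \<noteq> 0" using ngy P by auto
  then have n': "norm n' = 1" by (simp add: n'_def norm_sgn)
  have nn': "norm (n - n') \<le> 2 * \<epsilon> * \<Theta>"
  proof -
    have "norm (n' - n) \<le> 2 * norm (gx - gy) / P"
      using norm_sgn_diff_le[OF ngy(2) \<open>gx \<noteq> 0\<close>] ngy by (simp add: n'_def)
    also have "\<dots> \<le> 2 * (\<epsilon> * \<Theta> * P) / P"
      using gx P by (intro divide_right_mono) auto
    finally show ?thesis using P by (simp add: norm_minus_commute)
  qed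
  \<comment> \<open>This is \<kappa>0 of the remark above: the maximiser of 2 \<kappa> P^s - 4 D
    \<kappa>^2 / r^m, with maximum r^m P^(2s) / (4 D).\<close>
  define \<kappa> where "\<kappa> = r ^ m * P powr s / (4 * D)"
  have \<kappa>: "\<kappa> \<ge> 0" using r D by (simp add: \<kappa>_def)
  \<comment> \<open>Only the directions at y carry the extra factor. Stretching along
    \<open>n\<close> at y and \<open>n'\<close> at x makes the two sums over the basis equal to the
    operators in \<open>py\<close> and \<open>px\<close>.\<close>
  let ?\<tau> = "\<lambda>b. (1 + \<epsilon> * \<kappa>) *\<^sub>R stretch k n b" and ?\<xi> = "stretch k n'"
  have step: "Y (?\<tau> b) \<bullet> ?\<tau> b - X (?\<xi> b) \<bullet> ?\<xi> b \<le>
      \<epsilon> * K\<^sup>2 * (4 * \<kappa>\<^sup>2 / r ^ m + 64 * \<Theta>\<^sup>2 / r ^ m + C * P\<^sup>2 * r ^ j * R\<^sup>2)" if b: "b \<in> Basis" for b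
  proof -
    have \<xi>: "norm (?\<xi> b) \<le> K" using norm_stretch_le[OF n' b] by (simp add: K_def)
    \<comment> \<open>Both parts of this difference are O(\<epsilon>), so its square divided by
      \<epsilon> is again O(\<epsilon>), comparable with the gain \<epsilon> \<kappa> P^s.\<close>
    have "?\<tau> b - ?\<xi> b = (\<epsilon> * \<kappa>) *\<^sub>R stretch k n b + (stretch k n b - stretch k n' b)"
      by (simp add: algebra_simps)
    also have "norm \<dots> \<le> (\<epsilon> * \<kappa>) * norm (stretch k n b) + norm (stretch k n b - stretch k n' b)"
      using \<epsilon> \<kappa> by (intro norm_triangle_le) simp
    also have "\<dots> \<le> (\<epsilon> * \<kappa>) * K + 2 * K * (2 * \<epsilon> * \<Theta>)"
    proof (intro add_mono)
      show "(\<epsilon> * \<kappa>) * norm (stretch k n b) \<le> (\<epsilon> * \<kappa>) * K"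
        using norm_stretch_le[OF gy(2) b, of k] \<epsilon> \<kappa> by (intro mult_left_mono) (auto simp: K_def)
      have "norm (stretch k n b - stretch k n' b) \<le> 2 * \<bar>k - 1\<bar> * norm (n - n')"
        by (rule norm_stretch_diff_le[OF gy(2) n' b])
      also have "\<dots> \<le> 2 * K * (2 * \<epsilon> * \<Theta>)"
        by (intro mult_mono nn') (auto simp: K_def)
      finally show "norm (stretch k n b - stretch k n' b) \<le> 2 * K * (2 * \<epsilon> * \<Theta>)" .
    qed
    finally have "(norm (?\<tau> b - ?\<xi> b))\<^sup>2 \<le> (\<epsilon> * \<kappa> * K + 2 * K * (2 * \<epsilon> * \<Theta>))\<^sup>2"
      by (rule power_mono) simp
    also have "\<dots> \<le> 2 * (\<epsilon> * \<kappa> * K)\<^sup>2 + 2 * (2 * K * (2 * \<epsilon> * \<Theta>))\<^sup>2"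
      using sum_squares_bound[of "\<epsilon> * \<kappa> * K" "2 * K * (2 * \<epsilon> * \<Theta>)"] by (simp add: power2_sum)
    also have "\<dots> = \<epsilon>\<^sup>2 * K\<^sup>2 * (2 * \<kappa>\<^sup>2 + 32 * \<Theta>\<^sup>2)"
      by (simp add: power_mult_distrib algebra_simps)
    finally have "2 * (norm (?\<tau> b - ?\<xi> b))\<^sup>2 / (\<epsilon> * r ^ m) \<le> 2 * (\<epsilon>\<^sup>2 * K\<^sup>2 * (2 * \<kappa>\<^sup>2 + 32 * \<Theta>\<^sup>2)) / (\<epsilon> * r ^ m)"
      using \<epsilon> r by (intro divide_right_mono mult_left_mono) auto
    also have "\<dots> = \<epsilon> * K\<^sup>2 * (4 * \<kappa>\<^sup>2 / r ^ m + 64 * \<Theta>\<^sup>2 / r ^ m)"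
      using \<epsilon> r by (simp add: field_simps power2_eq_square)
    finally have 1: "2 * (norm (?\<tau> b - ?\<xi> b))\<^sup>2 / (\<epsilon> * r ^ m) \<le> \<epsilon> * K\<^sup>2 * (4 * \<kappa>\<^sup>2 / r ^ m + 64 * \<Theta>\<^sup>2 / r ^ m)" .
    have 2: "\<epsilon> * C * P\<^sup>2 * r ^ j * R\<^sup>2 * (norm (?\<xi> b))\<^sup>2 \<le> \<epsilon> * C * P\<^sup>2 * r ^ j * R\<^sup>2 * K\<^sup>2"
      using \<epsilon> C r \<xi> by (intro mult_left_mono power_mono) auto
    show ?thesis
      using so[of "?\<tau> b" "?\<xi> b"] 1 2 by (simp add: C_def algebra_simps)
  qed
  have "(1 + \<epsilon> * \<kappa>)\<^sup>2 * P powr s - norm gx powr s = (\<Sum>b\<in>Basis. Y (?\<tau> b) \<bullet> ?\<tau> b - X (?\<xi> b) \<bullet> ?\<xi> b)"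
    using trace_stretch[OF lin(2) gy(2), of k] trace_stretch[OF lin(1) n', of k] py px
    by (simp add: sum_subtractf linear_cmul[OF lin(2)] sum_distrib_left[symmetric] power2_eq_square n'_def mult.assoc)
  also have "\<dots> \<le> N * (\<epsilon> * K\<^sup>2 * (4 * \<kappa>\<^sup>2 / r ^ m + 64 * \<Theta>\<^sup>2 / r ^ m + C * P\<^sup>2 * r ^ j * R\<^sup>2))"
    unfolding N_def by (rule sum_bounded_above) (use step in auto)
  also have "64 * \<Theta>\<^sup>2 / r ^ m = 64 * (real m)\<^sup>2 * P\<^sup>2 * r ^ j * R\<^sup>2"
    using r by (simp add: \<Theta> m(2) power_mult_distrib power_add) (simp add: field_simps power2_eq_square)
  finally have up: "(1 + \<epsilon> * \<kappa>)\<^sup>2 * P powr s - norm gx powr s \<le>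
      \<epsilon> * D * (4 * \<kappa>\<^sup>2 / r ^ m + (64 * (real m)\<^sup>2 + C) * P\<^sup>2 * r ^ j * R\<^sup>2)"
    by (simp add: D_def algebra_simps)
  have "norm gx \<le> P * (1 + \<epsilon> * \<Theta>)"
    using gx norm_triangle_ineq[of gy "gx - gy"] ngy by (simp add: algebra_simps)
  then have "norm gx powr s \<le> (P * (1 + \<epsilon> * \<Theta>)) powr s"
    using s by (intro powr_mono2) auto
  also have "\<dots> = P powr s * (1 + \<epsilon> * \<Theta>) powr s"
    using P \<epsilon> \<Theta>0 by (simp add: powr_mult)
  also have "\<dots> \<le> P powr s * (1 + 2 powr s * (\<epsilon> * \<Theta>))"
    using \<epsilon> \<Theta>0 small s by (intro mult_left_mono one_plus_powr_le) auto
  finally have low1: "norm gx powr s \<le> P powr s * (1 + 2 powr s * (\<epsilon> * \<Theta>))" .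
  have low2: "(1 + 2 * (\<epsilon> * \<kappa>)) * P powr s \<le> (1 + \<epsilon> * \<kappa>)\<^sup>2 * P powr s"
    by (intro mult_right_mono) (auto simp: power2_sum)
  have "\<epsilon> * (2 * \<kappa> * P powr s - 2 powr s * \<Theta> * P powr s) \<le>
      \<epsilon> * (D * (4 * \<kappa>\<^sup>2 / r ^ m + (64 * (real m)\<^sup>2 + C) * P\<^sup>2 * r ^ j * R\<^sup>2))"
    using up low1 low2 by (simp add: algebra_simps)
  then have "2 * \<kappa> * P powr s - 2 powr s * \<Theta> * P powr s \<le>
      D * (4 * \<kappa>\<^sup>2 / r ^ m + (64 * (real m)\<^sup>2 + C) * P\<^sup>2 * r ^ j * R\<^sup>2)"
    using \<epsilon> by (simp only: mult_le_cancel_left_pos)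
  moreover have "2 * \<kappa> * P powr s - D * (4 * \<kappa>\<^sup>2 / r ^ m) = r ^ m * (P powr s)\<^sup>2 / (4 * D)"
    using r D by (simp add: \<kappa>_def field_simps power2_eq_square)
  ultimately have "r ^ m * (P powr s)\<^sup>2 / (4 * D) \<le>
      2 powr s * \<Theta> * P powr s + D * (64 * (real m)\<^sup>2 + C) * P\<^sup>2 * r ^ j * R\<^sup>2"
    by (simp add: algebra_simps)
  \<comment> \<open>Every term contains P^2 r^j; cancelling it leaves a quadratic inequality for the
    single quantity \<open>r * T\<close>.\<close>
  also have "r ^ m * (P powr s)\<^sup>2 / (4 * D) = (P\<^sup>2 * r ^ j) * (r\<^sup>2 * T\<^sup>2 / (4 * D))"
    by (simp add: PT m(2) power_mult_distrib)
  also have "2 powr s * \<Theta> * P powr s = (P\<^sup>2 * r ^ j) * (2 powr s * m * R * r * T)"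
    by (simp add: PT \<Theta> power2_eq_square)
  also have "(P\<^sup>2 * r ^ j) * (2 powr s * m * R * r * T) + D * (64 * (real m)\<^sup>2 + C) * P\<^sup>2 * r ^ j * R\<^sup>2 =
     (P\<^sup>2 * r ^ j) * (2 powr s * m * R * r * T + D * (64 * (real m)\<^sup>2 + C) * R\<^sup>2)"
    by (simp add: algebra_simps)
  finally have "r\<^sup>2 * T\<^sup>2 / (4 * D) \<le> 2 powr s * m * R * r * T + D * (64 * (real m)\<^sup>2 + C) * R\<^sup>2"
    using P r by (subst (asm) mult_le_cancel_left_pos) auto
  then have q: "(r * T)\<^sup>2 \<le> 4 * D * (2 powr s * m * R * (r * T) + D * (64 * (real m)\<^sup>2 + C) * R\<^sup>2)"
    using D by (simp add: pos_divide_le_eq power_mult_distrib algebra_simps)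
  define A where "A = 4 * D * (2 powr s * m + D * (64 * (real m)\<^sup>2 + C))"
  have A: "A \<ge> 0" using D C by (simp add: A_def)
  have q': "(r * T)\<^sup>2 \<le> A * (R * (r * T)) + A * R\<^sup>2"
  proof -
    have "4 * D * (2 powr s * m) * (R * (r * T)) \<le> A * (R * (r * T))"
      unfolding A_def using D C r R T by (intro mult_right_mono mult_left_mono) auto
    moreover have "4 * D * (D * (64 * (real m)\<^sup>2 + C)) * R\<^sup>2 \<le> A * R\<^sup>2"
      unfolding A_def using D by (intro mult_right_mono mult_left_mono) auto
    ultimately show ?thesis using q by (simp add: algebra_simps)
  qed
  \<comment> \<open>A number X > 0 with X^2 \<le> A R X + A R^2 cannot exceed (1 + A) R: otherwise A
    R^2 \<le> R X, and the right side would be at most (1 + A) R X < X^2.\<close>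
  have "r * T \<le> (1 + A) * R"
  proof (rule ccontr)
    assume "\<not> r * T \<le> (1 + A) * R"
    then have gt: "r * T > (1 + A) * R" by simp
    then have gt1: "r * T > R" using A R by (simp add: algebra_simps) (smt (verit) mult_nonneg_nonneg)
    have "A * (R * (r * T)) + A * R\<^sup>2 \<le> A * (R * (r * T)) + R * (A * R)"
      by (simp add: power2_eq_square)
    also have "\<dots> \<le> A * (R * (r * T)) + R * (r * T)"
      using gt R by (intro add_left_mono mult_left_mono) (auto simp: algebra_simps)
    also have "\<dots> = ((1 + A) * R) * (r * T)" by (simp add: algebra_simps)
    also have "\<dots> < (r * T) * (r * T)"
      using gt r T by (intro mult_strict_right_mono) auto
    finally show False using q' by (simp add: power2_eq_square)
  qed
  also have "1 + A = doubling_const DIM('a) k s m"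
    by (simp add: A_def doubling_const_def D_def N_def K_def C_def algebra_simps)
  finally show ?thesis by (simp add: T_def)
qed

section \<open>From the maximum of the penalised function to the gradient at the centre\<close>

lemma mean_value_grad:
  assumes u: "Ck_on 2 u S" and B: "convex B" "B \<subseteq> S" and xy: "x \<in> B" "y \<in> B"
  obtains z where "z \<in> B" "u y - u x = grad u z \<bullet> (y - x)" "norm (z - x) \<le> norm (y - x)" "norm (z - y) \<le> norm (y - x)"
proof -
  have seg: "x + t *\<^sub>R (y - x) \<in> B" if "0 \<le> t" "t \<le> 1" for t
    using convexD_alt[OF B(1) xy that] by (simp add: algebra_simps)
  have "\<exists>t. 0 < t \<and> t < 1 \<and> u (x + 1 *\<^sub>R (y - x)) - u (x + 0 *\<^sub>R (y - x)) = (1 - 0) * (grad u (x + t *\<^sub>R (y - x)) \<bullet> (y - x))"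
    by (rule MVT2) (auto intro!: DERIV_along_line(1)[OF u] subsetD[OF B(2)] seg)
  then obtain t where t: "0 < t" "t < 1" "u (x + 1 *\<^sub>R (y - x)) - u (x + 0 *\<^sub>R (y - x)) = (1 - 0) * (grad u (x + t *\<^sub>R (y - x)) \<bullet> (y - x))"
    by blast
  show ?thesis
  proof (rule that)
    show "x + t *\<^sub>R (y - x) \<in> B" using seg t by simp
    show "u y - u x = grad u (x + t *\<^sub>R (y - x)) \<bullet> (y - x)" using t by simp
    show "norm (x + t *\<^sub>R (y - x) - x) \<le> norm (y - x)" using t by (simp add: mult_left_le_one_le)
    have "x + t *\<^sub>R (y - x) - y = - ((1 - t) *\<^sub>R (y - x))" by (simp add: algebra_simps)
    then show "norm (x + t *\<^sub>R (y - x) - y) \<le> norm (y - x)"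
      using t by (simp add: mult_left_le_one_le)
  qed
qed

text \<open>Moving the pair along a line reduces the doubled maximum to the one-variable test, since
  |y - x|^2 and \<open>r\<close> are quadratic polynomials along it. By the first conclusion
  \<open>P\<close> is the norm of \<open>grad u y\<close>.\<close>

lemma doubling_at_max:
  fixes u :: "'a::euclidean_space \<Rightarrow> real" and j :: nat
  defines "m \<equiv> j + 2"
  assumes \<Omega>: "open \<Omega>" and u: "Ck_on 2 u \<Omega>" and xy: "x \<in> \<Omega>" "y \<in> \<Omega>"
    and xR: "norm (x - x0) < R" and \<epsilon>: "\<epsilon> > 0"
  defines "r \<equiv> \<lambda>z. R\<^sup>2 - (norm (z - x0))\<^sup>2"
  defines "P \<equiv> norm (y - x) / (\<epsilon> * r x ^ m)"
  assumes locmax: "\<And>\<tau> \<xi>. \<exists>\<delta>>0. \<forall>t. \<bar>t\<bar> < \<delta> \<longrightarrow>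
      u (y + t *\<^sub>R \<tau>) - u (x + t *\<^sub>R \<xi>) - (norm (y - x + t *\<^sub>R (\<tau> - \<xi>)))\<^sup>2 / r (x + t *\<^sub>R \<xi>) ^ m / (2 * \<epsilon>)
      \<le> u y - u x - (norm (y - x))\<^sup>2 / r x ^ m / (2 * \<epsilon>)"
  shows "grad u y = (1 / (\<epsilon> * r x ^ m)) *\<^sub>R (y - x)"
    and "grad u x = grad u y - (m * \<epsilon> * P\<^sup>2 * r x ^ (j + 1)) *\<^sub>R (x - x0)"
    and "hess u y \<tau> \<bullet> \<tau> - hess u x \<xi> \<bullet> \<xi> \<le>
      2 * (norm (\<tau> - \<xi>))\<^sup>2 / (\<epsilon> * r x ^ m) + \<epsilon> * (6 * (real m)\<^sup>2 + 3 * real m) * P\<^sup>2 * r x ^ j * R\<^sup>2 * (norm \<xi>)\<^sup>2"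
proof -
  have R: "R > 0" using xR norm_ge_zero[of "x - x0"] by linarith
  have rx: "r x > 0" "r x \<le> R\<^sup>2"
    using power_strict_mono[OF xR, of 2] by (auto simp: r_def)
  define r0 where "r0 = r x"
  define e where "e = y - x"
  have r0: "r0 > 0" "r0 \<le> R\<^sup>2" using rx by (auto simp: r0_def)
  have ne: "norm e = \<epsilon> * r0 ^ m * P" using r0 \<epsilon> by (simp add: P_def r0_def e_def)
  have P0: "P \<ge> 0" using rx \<epsilon> by (simp add: P_def)
  \<comment> \<open>The two directions are independent of each other; the later estimate relies on
    choosing them differently.\<close>
  have main: "grad u y \<bullet> \<tau> - grad u x \<bullet> \<xi> =
        (2 * (e \<bullet> (\<tau> - \<xi>)) * r0 - m * (norm e)\<^sup>2 * (- 2 * ((x - x0) \<bullet> \<xi>))) / r0 ^ Suc m / (2 * \<epsilon>) \<and>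
      hess u y \<tau> \<bullet> \<tau> - hess u x \<xi> \<bullet> \<xi> \<le>
      2 * (norm (\<tau> - \<xi>))\<^sup>2 / (\<epsilon> * r0 ^ m) + \<epsilon> * (6 * (real m)\<^sup>2 + 3 * real m) * P\<^sup>2 * r0 ^ j * R\<^sup>2 * (norm \<xi>)\<^sup>2" for \<tau> \<xi>
  proof -
    define a where "a = - 2 * ((x - x0) \<bullet> \<xi>)"
    define c where "c = (norm \<xi>)\<^sup>2"
    define g0 where "g0 = (norm e)\<^sup>2"
    define g1 where "g1 = 2 * (e \<bullet> (\<tau> - \<xi>))"
    define g2 where "g2 = (norm (\<tau> - \<xi>))\<^sup>2"
    have r_eq: "r (x + t *\<^sub>R \<xi>) = r0 + a * t - c * t\<^sup>2" for t
    proof -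
      have "x + t *\<^sub>R \<xi> - x0 = (x - x0) + t *\<^sub>R \<xi>" by simp
      then show ?thesis
        unfolding r_def r0_def a_def c_def power2_norm_eq_inner
        by (simp only:) (simp add: inner_add_left inner_add_right inner_commute power2_eq_square)
    qed
    have g_eq: "(norm (y - x + t *\<^sub>R (\<tau> - \<xi>)))\<^sup>2 = g0 + g1 * t + g2 * t\<^sup>2" for t
      unfolding g0_def g1_def g2_def power2_norm_eq_inner e_def[symmetric]
      by (simp add: inner_add_left inner_add_right inner_commute power2_eq_square)
    define f where "f t = u (y + t *\<^sub>R \<tau>) - u (x + t *\<^sub>R \<xi>)
        - (g0 + g1 * t + g2 * t\<^sup>2) / (r0 + a * t - c * t\<^sup>2) ^ m / (2 * \<epsilon>)" for t
    define Q' where "Q' t = ((g1 + 2 * g2 * t) * (r0 + a * t - c * t\<^sup>2) -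
        m * (g0 + g1 * t + g2 * t\<^sup>2) * (a - 2 * c * t)) / (r0 + a * t - c * t\<^sup>2) ^ Suc m / (2 * \<epsilon>)" for t
    define Q'' where "Q'' = (2 * g2 * r0\<^sup>2 - 2 * real m * g1 * a * r0 + 2 * real m * g0 * c * r0 + real m * (real m + 1) * g0 * a\<^sup>2)
        / r0 ^ (m + 2) / (2 * \<epsilon>)"
    define f' where "f' t = grad u (y + t *\<^sub>R \<tau>) \<bullet> \<tau> - grad u (x + t *\<^sub>R \<xi>) \<bullet> \<xi> - Q' t" for t
    obtain \<delta>1 where \<delta>1: "\<delta>1 > 0" "\<And>t. \<bar>t\<bar> < \<delta>1 \<Longrightarrow> f t \<le> f 0"
      using locmax[of \<tau> \<xi>] unfolding r_eq g_eq f_def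
      by (auto simp: g0_def e_def r0_def)
    have lim: "((\<lambda>t. y + t *\<^sub>R \<tau>) \<longlongrightarrow> y) (nhds 0)" "((\<lambda>t. x + t *\<^sub>R \<xi>) \<longlongrightarrow> x) (nhds 0)"
      "((\<lambda>t. r0 + a * t - c * t\<^sup>2) \<longlongrightarrow> r0) (nhds 0)"
      by (auto intro!: tendsto_eq_intros filterlim_ident)
    have "\<forall>\<^sub>F t in nhds 0. y + t *\<^sub>R \<tau> \<in> \<Omega>" "\<forall>\<^sub>F t in nhds 0. x + t *\<^sub>R \<xi> \<in> \<Omega>"
      "\<forall>\<^sub>F t in nhds 0. r0 + a * t - c * t\<^sup>2 > 0"
      by (rule topological_tendstoD[OF lim(1) \<Omega> xy(2)] topological_tendstoD[OF lim(2) \<Omega> xy(1)]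
          order_tendstoD(1)[OF lim(3) r0(1)])+
    then have "\<forall>\<^sub>F t in nhds 0. y + t *\<^sub>R \<tau> \<in> \<Omega> \<and> x + t *\<^sub>R \<xi> \<in> \<Omega> \<and> r0 + a * t - c * t\<^sup>2 > 0"
      by (intro eventually_conj)
    then obtain \<delta>2 where \<delta>2: "\<delta>2 > 0" "\<And>t. \<bar>t\<bar> < \<delta>2 \<Longrightarrow> y + t *\<^sub>R \<tau> \<in> \<Omega> \<and> x + t *\<^sub>R \<xi> \<in> \<Omega> \<and> r0 + a * t - c * t\<^sup>2 > 0"
      by (auto simp: eventually_nhds_metric dist_real_def)
    have der: "(f has_real_derivative f' t) (at t)" if "\<bar>t\<bar> < \<delta>2" for t
      unfolding f_def f'_def Q'_def
      using \<delta>2(2)[OF that]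
      by (intro DERIV_diff DERIV_along_line(1)[OF u] penalty_derivatives(1)[OF r0(1) \<epsilon>]) auto
    have "y + 0 *\<^sub>R \<tau> \<in> \<Omega>" "x + 0 *\<^sub>R \<xi> \<in> \<Omega>" using xy by auto
    then have der2: "(f' has_real_derivative hess u (y + 0 *\<^sub>R \<tau>) \<tau> \<bullet> \<tau> - hess u (x + 0 *\<^sub>R \<xi>) \<xi> \<bullet> \<xi> - Q'') (at 0)"
      unfolding f'_def Q'_def Q''_def
      by (intro DERIV_diff DERIV_along_line(2)[OF u] penalty_derivatives(2)[OF r0(1) \<epsilon>])
    note max = second_derivative_nonpos_at_local_max[of "min \<delta>1 \<delta>2" f f', OF _ _ der2]
    have 1: "f' 0 = 0" by (rule max(1)) (use \<delta>1 \<delta>2(1) der in auto)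
    have 2: "hess u (y + 0 *\<^sub>R \<tau>) \<tau> \<bullet> \<tau> - hess u (x + 0 *\<^sub>R \<xi>) \<xi> \<bullet> \<xi> - Q'' \<le> 0"
      by (rule max(2)) (use \<delta>1 \<delta>2(1) der in auto)
    have "Q'' \<le> 2 * (norm (\<tau> - \<xi>))\<^sup>2 / (\<epsilon> * r0 ^ m) + \<epsilon> * (6 * (real m)\<^sup>2 + 3 * real m) * P\<^sup>2 * r0 ^ j * R\<^sup>2 * (norm \<xi>)\<^sup>2"
      unfolding Q''_def m_def
    proof (rule penalty_second_derivative_le[OF r0 \<epsilon> R P0 norm_ge_zero norm_ge_zero])
      have "\<bar>(x - x0) \<bullet> \<xi>\<bar> \<le> R * norm \<xi>"
        using Cauchy_Schwarz_ineq2[of "x - x0" \<xi>] xR by (smt (verit) mult_right_mono norm_ge_zero)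
      then show "\<bar>a\<bar> \<le> 2 * R * norm \<xi>" by (simp add: a_def abs_mult)
      show "\<bar>g1\<bar> \<le> 2 * (\<epsilon> * r0 ^ (j + 2) * P) * norm (\<tau> - \<xi>)"
        using Cauchy_Schwarz_ineq2[of e "\<tau> - \<xi>"] ne by (simp add: g1_def m_def abs_mult)
    qed (use ne in \<open>auto simp: c_def g0_def g2_def m_def\<close>)
    with 1 2 show ?thesis by (simp add: f'_def Q'_def a_def g0_def g1_def)
  qed
  show 1: "grad u y = (1 / (\<epsilon> * r x ^ m)) *\<^sub>R (y - x)"
  proof (rule vector_eq_rdot[THEN iffD1], rule allI)
    fix \<tau>
    \<comment> \<open>Keeping x fixed removes the derivative of the weight.\<close>
    show "grad u y \<bullet> \<tau> = (1 / (\<epsilon> * r x ^ m)) *\<^sub>R (y - x) \<bullet> \<tau>"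
      using main[of \<tau> 0] r0 \<epsilon> unfolding inner_scaleR_left by (simp add: e_def r0_def field_simps)
  qed
  show "grad u x = grad u y - (m * \<epsilon> * P\<^sup>2 * r x ^ (j + 1)) *\<^sub>R (x - x0)"
  proof (rule vector_eq_rdot[THEN iffD1], rule allI)
    fix \<xi>
    \<comment> \<open>Moving both points together leaves |y - x| unchanged, so only the weight
      contributes.\<close>
    have "grad u y \<bullet> \<xi> - grad u x \<bullet> \<xi> = m * (norm e)\<^sup>2 * (2 * ((x - x0) \<bullet> \<xi>)) / r0 ^ Suc m / (2 * \<epsilon>)"
      using main[of \<xi> \<xi>] by simp
    also have "\<dots> = m * \<epsilon> * P\<^sup>2 * r0 ^ (j + 1) * ((x - x0) \<bullet> \<xi>)"
      using r0 \<epsilon> by (simp add: ne m_def power_mult_distrib field_simps power2_eq_square)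
    finally show "grad u x \<bullet> \<xi> = (grad u y - (m * \<epsilon> * P\<^sup>2 * r x ^ (j + 1)) *\<^sub>R (x - x0)) \<bullet> \<xi>"
      by (simp add: inner_diff_left r0_def)
  qed
  show "hess u y \<tau> \<bullet> \<tau> - hess u x \<xi> \<bullet> \<xi> \<le>
      2 * (norm (\<tau> - \<xi>))\<^sup>2 / (\<epsilon> * r x ^ m) + \<epsilon> * (6 * (real m)\<^sup>2 + 3 * real m) * P\<^sup>2 * r x ^ j * R\<^sup>2 * (norm \<xi>)\<^sup>2"
    using main[of \<tau> \<xi>] by (simp add: r0_def)
qed

text \<open>The estimate for one fixed \<epsilon>; \<open>L\<close> and \<open>H\<close> appear only
  in the last summand. The first smallness condition keeps shifted points in the ball and the two
  gradients relatively close, the second makes the maximum positive.\<close>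

lemma grad_estimate_penalised:
  fixes u :: "'a::euclidean_space \<Rightarrow> real" and j :: nat
  defines "m \<equiv> j + 2"
  assumes \<Omega>: "open \<Omega>" and u: "Ck_on 2 u \<Omega>"
    and pde: "\<And>z. z \<in> \<Omega> \<Longrightarrow> grad u z \<noteq> 0 \<Longrightarrow>
      (\<Sum>b\<in>Basis. hess u z b \<bullet> b) + (k\<^sup>2 - 1) * (hess u z (sgn (grad u z)) \<bullet> sgn (grad u z)) = norm (grad u z) powr s"
    and s: "s > 1" and R: "R > 0" and ball: "cball x0 R \<subseteq> \<Omega>" and m: "2 / (s - 1) \<le> m"
    and L: "\<And>z. z \<in> cball x0 R \<Longrightarrow> norm (grad u z) \<le> L" "L > 0"
    and H: "\<And>z h. z \<in> cball x0 R \<Longrightarrow> norm (hess u z h) \<le> H * norm h" "H \<ge> 0"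
    and \<epsilon>: "\<epsilon> > 0" "\<epsilon> * (4 * m * L * R ^ (2 * j + 3)) < 1" "2 * H * \<epsilon> * R ^ (2 * m) < 1"
    and nz: "grad u x0 \<noteq> 0"
  shows "R ^ (2 * m) * (norm (grad u x0))\<^sup>2 \<le>
    (doubling_const DIM('a) k s m * R) powr (2 / (s - 1)) * (R\<^sup>2) powr (m - 2 / (s - 1))
     + 4 * H * \<epsilon> * (R ^ (2 * m))\<^sup>2 * L\<^sup>2"
proof -
  let ?B = "cball x0 R"
  define r where "r z = R\<^sup>2 - (norm (z - x0))\<^sup>2" for z
  define Z where "Z = R ^ (2 * m)"
  have Z: "Z > 0" using R by (simp add: Z_def)
  have r_le: "r z \<le> R\<^sup>2" for z by (simp add: r_def)
  have inB: "z \<in> ?B \<longleftrightarrow> norm (z - x0) \<le> R" for z by (simp add: dist_norm norm_minus_commute)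
  have r_nonneg: "r z \<ge> 0" if "z \<in> ?B" for z
    using power_mono[of "norm (z - x0)" R 2] that[unfolded inB] by (simp add: r_def)
  have r_pos: "r z > 0 \<longleftrightarrow> norm (z - x0) < R" for z
    using R power2_less_imp_less[of "norm (z - x0)" R] power_strict_mono[of "norm (z - x0)" R 2]
    by (auto simp: r_def)
  have rm_le: "r z ^ m \<le> Z" if "z \<in> ?B" for z
    using power_mono[OF r_le r_nonneg[OF that], of m] by (simp add: Z_def power_mult)
  have r0: "r x0 = R\<^sup>2" "r x0 ^ m = Z" by (simp_all add: r_def Z_def power_mult)
  have Rj: "R ^ (2 * j + 3) = (R\<^sup>2) ^ (j + 1) * R"
  proof -
    have "2 * j + 3 = Suc (2 * (j + 1))" by simp
    then show ?thesis by (simp only: power_mult power_Suc2)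
  qed
  \<comment> \<open>The largest admissible displacement is at most the distance to the sphere,
    because \<rho> itself is at most 2 R times that distance.\<close>
  have L\<epsilon>: "2 * \<epsilon> * L * r z ^ m \<le> R - norm (z - x0)" if "z \<in> ?B" for z
  proof -
    let ?d = "norm (z - x0)"
    have d: "0 \<le> ?d" "?d \<le> R" using that[unfolded inB] by auto
    have "r z ^ m = r z ^ (j + 1) * r z" by (simp add: m_def)
    also have "\<dots> \<le> (R\<^sup>2) ^ (j + 1) * r z"
      using r_le r_nonneg[OF that] by (intro mult_right_mono power_mono) auto
    also have "r z \<le> (2 * R) * (R - ?d)"
    proof -
      have "r z = (R + ?d) * (R - ?d)" by (simp add: r_def power2_eq_square algebra_simps)
      also have "\<dots> \<le> (2 * R) * (R - ?d)" using d by (intro mult_right_mono) auto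
      finally show ?thesis .
    qed
    finally have "r z ^ m \<le> (R\<^sup>2) ^ (j + 1) * (2 * R * (R - ?d))"
      by (simp add: mult_left_mono)
    also have "\<dots> = 2 * R ^ (2 * j + 3) * (R - ?d)"
      unfolding Rj by (simp only: ac_simps)
    finally have "2 * \<epsilon> * L * r z ^ m \<le> 2 * \<epsilon> * L * (2 * R ^ (2 * j + 3) * (R - ?d))"
      using \<epsilon>(1) L(2) by (intro mult_left_mono) auto
    also have "\<dots> = (\<epsilon> * (4 * 1 * L * R ^ (2 * j + 3))) * (R - ?d)" by (simp add: algebra_simps)
    also have "\<dots> \<le> (\<epsilon> * (4 * m * L * R ^ (2 * j + 3))) * (R - ?d)"
      using \<epsilon>(1) L(2) R d by (intro mult_right_mono mult_left_mono) (auto simp: m_def)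
    also have "\<dots> \<le> 1 * (R - ?d)" using \<epsilon>(2) d by (intro mult_right_mono) auto
    finally show ?thesis by simp
  qed
  have shift: "x + (r x ^ m) *\<^sub>R w \<in> ?B" if "x \<in> ?B" "norm w \<le> 2 * \<epsilon> * L" for x w
  proof -
    have "norm ((r x ^ m) *\<^sub>R w) \<le> r x ^ m * (2 * \<epsilon> * L)"
      using that r_nonneg[OF that(1)] by (simp add: mult_left_mono)
    also have "\<dots> \<le> R - norm (x - x0)" using L\<epsilon>[OF that(1)] by (simp add: mult.commute)
    finally have "norm ((x - x0) + (r x ^ m) *\<^sub>R w) \<le> R"
      using norm_triangle_ineq[of "x - x0" "(r x ^ m) *\<^sub>R w"] by linarith
    then show ?thesis unfolding inB by (simp add: algebra_simps)
  qed
  \<comment> \<open>The substitution \<open>y = x + \<rho>\<^sup>m w\<close> makes the penalised function continuous up to \<open>\<rho> = 0\<close>.\<close>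
  define \<Psi> where "\<Psi> = (\<lambda>(x, w). u (x + (r x ^ m) *\<^sub>R w) - u x - r x ^ m * (norm w)\<^sup>2 / (2 * \<epsilon>))"
  let ?K = "?B \<times> cball (0::'a) (2 * \<epsilon> * L)"
  have "continuous_on ?K \<Psi>"
  proof -
    have cu: "continuous_on ?B u" by (rule continuous_on_subset[OF continuous_on_C2[OF u] ball])
    have "continuous_on ?K (\<lambda>z. u (fst z + (r (fst z) ^ m) *\<^sub>R snd z))"
    proof (rule continuous_on_compose2[OF cu])
      show "continuous_on ?K (\<lambda>z. fst z + (r (fst z) ^ m) *\<^sub>R snd z)"
        unfolding r_def by (intro continuous_intros)
      show "(\<lambda>z. fst z + (r (fst z) ^ m) *\<^sub>R snd z) ` ?K \<subseteq> ?B"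
        using shift by (intro image_subsetI) (auto simp del: mem_cball simp: mem_cball_0)
    qed
    moreover have "continuous_on ?K (\<lambda>z. u (fst z))"
      by (rule continuous_on_compose2[OF cu]) (auto intro!: continuous_intros)
    ultimately show ?thesis
      unfolding \<Psi>_def case_prod_unfold r_def using \<epsilon>(1) by (intro continuous_intros) (auto simp: r_def)
  qed
  moreover have "compact ?K" by (intro compact_Times compact_cball)
  moreover have "(x0, 0) \<in> ?K" using R \<epsilon>(1) L(2) by simp
  then have "?K \<noteq> {}" by blast
  ultimately obtain x w where xw: "x \<in> ?B" "norm w \<le> 2 * \<epsilon> * L" and
    max: "\<And>x' w'. x' \<in> ?B \<Longrightarrow> norm w' \<le> 2 * \<epsilon> * L \<Longrightarrow> \<Psi> (x', w') \<le> \<Psi> (x, w)"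
    using continuous_attains_sup[of ?K \<Psi>] by auto
  define g0 where "g0 = grad u x0"
  have g0: "norm g0 > 0" "norm g0 \<le> L" using nz L(1)[of x0] R by (auto simp: g0_def)
  \<comment> \<open>Lower bound for the maximum, from the pair with x = x0 and w = \<epsilon>
    \<open>g0\<close>. This w maximises the linearised expression Z (g0 . w - |w|^2 / (2
    \<epsilon>)), with value \<epsilon> Z |g0|^2 / 2; \<open>H\<close> controls the linearisation
    error.\<close>
  have centre: "\<epsilon> * Z * (norm g0)\<^sup>2 * (1 / 2 - H * \<epsilon> * Z) \<le> \<Psi> (x, w)"
  proof -
    have x0B: "x0 \<in> ?B" using R by simp
    have w0: "norm (\<epsilon> *\<^sub>R g0) \<le> 2 * \<epsilon> * L" using g0 \<epsilon>(1) L(2) by (simp add: mult_mono)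
    define v where "v = (Z * \<epsilon>) *\<^sub>R g0"
    have nv: "norm v = Z * \<epsilon> * norm g0" using Z \<epsilon> by (simp add: v_def)
    have v: "x0 + (r x0 ^ m) *\<^sub>R (\<epsilon> *\<^sub>R g0) = x0 + v" by (simp add: v_def r0(2))
    then have "x0 + v \<in> ?B" using shift[OF x0B w0] by simp
    then obtain z where z: "z \<in> ?B" "u (x0 + v) - u x0 = grad u z \<bullet> v" "norm (z - x0) \<le> norm v"
      using mean_value_grad[OF u convex_cball ball x0B] by (metis add_diff_cancel_left')
    have "\<bar>(grad u z - g0) \<bullet> v\<bar> \<le> norm (grad u z - g0) * norm v" by (rule Cauchy_Schwarz_ineq2)
    also have "\<dots> \<le> (H * norm v) * norm v"
      using grad_lipschitz[OF u ball convex_cball H(1) z(1) x0B] z(3) H(2)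
      by (intro mult_right_mono) (auto simp: g0_def intro: order_trans mult_left_mono)
    finally have "u (x0 + v) - u x0 \<ge> g0 \<bullet> v - H * (norm v)\<^sup>2"
      using z(2) by (simp add: inner_diff_left power2_eq_square)
    also have "g0 \<bullet> v = Z * \<epsilon> * (norm g0)\<^sup>2" by (simp add: v_def power2_norm_eq_inner)
    finally have "Z * \<epsilon> * (norm g0)\<^sup>2 - H * (Z * \<epsilon> * norm g0)\<^sup>2 - Z * (\<epsilon> * norm g0)\<^sup>2 / (2 * \<epsilon>) \<le> \<Psi> (x0, \<epsilon> *\<^sub>R g0)"
      using \<epsilon>(1) by (simp add: \<Psi>_def r0(2) nv v_def[symmetric])
    also have "\<dots> \<le> \<Psi> (x, w)" by (rule max[OF x0B w0])
    finally show ?thesis using \<epsilon>(1) by (simp add: power2_eq_square field_simps)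
  qed
  have "\<epsilon> * Z * (norm g0)\<^sup>2 * (1 / 2 - H * \<epsilon> * Z) > 0"
    using \<epsilon> Z g0 by (simp add: Z_def algebra_simps)
  then have pos: "\<Psi> (x, w) > 0" using centre by simp
  define y where "y = x + (r x ^ m) *\<^sub>R w"
  have yB: "y \<in> ?B" using shift[OF xw] by (simp add: y_def)
  \<comment> \<open>Where \<open>r x\<close> vanishes the two points coincide and \<Psi> is zero, as
    \<open>m\<close> is positive; a positive maximum therefore forces \<open>x\<close> into the open
    ball.\<close>
  have "r x \<noteq> 0" using pos by (auto simp: \<Psi>_def m_def)
  then have rx: "r x > 0" using r_nonneg[OF xw(1)] by simp
  then have xR: "norm (x - x0) < R" by (simp add: r_pos)
  
  have "w \<noteq> 0" using pos by (auto simp: \<Psi>_def)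
  have ne: "norm (y - x) = r x ^ m * norm w" using rx by (simp add: y_def)
  \<comment> \<open>Positivity of the maximum together with the gradient bound makes the constraint
    on \<open>w\<close> strict, so the maximum is a local one under free variation of x and
    y.\<close>
  have wL: "norm w < 2 * \<epsilon> * L"
  proof -
    obtain z where z: "z \<in> ?B" "u y - u x = grad u z \<bullet> (y - x)"
      using mean_value_grad[OF u convex_cball ball xw(1) yB] by metis
    have "u y - u x \<le> L * (r x ^ m * norm w)"
      using Cauchy_Schwarz_ineq2[of "grad u z" "y - x"] mult_right_mono[OF L(1)[OF z(1)] norm_ge_zero[of "y - x"]] z(2)
      by (simp add: ne)
    then have "r x ^ m * norm w * (norm w / (2 * \<epsilon>)) < r x ^ m * norm w * L"
      using pos by (simp add: \<Psi>_def y_def[symmetric] power2_eq_square algebra_simps)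
    then have "norm w / (2 * \<epsilon>) < L"
      using rx \<open>w \<noteq> 0\<close> by (subst (asm) mult_less_cancel_left_pos) auto
    then show ?thesis using \<epsilon>(1) by (simp add: pos_divide_less_eq algebra_simps)
  qed
  have x\<Omega>: "x \<in> \<Omega>" and y\<Omega>: "y \<in> \<Omega>" using xw(1) yB ball by auto
  have pen: "r x ^ m * (norm w)\<^sup>2 / (2 * \<epsilon>) = (norm (y - x))\<^sup>2 / r x ^ m / (2 * \<epsilon>)"
    using rx by (simp add: ne power2_eq_square)
  have locmax: "\<exists>\<delta>>0. \<forall>t. \<bar>t\<bar> < \<delta> \<longrightarrow>
      u (y + t *\<^sub>R \<tau>) - u (x + t *\<^sub>R \<xi>) - (norm (y - x + t *\<^sub>R (\<tau> - \<xi>)))\<^sup>2 / r (x + t *\<^sub>R \<xi>) ^ m / (2 * \<epsilon>)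
      \<le> u y - u x - (norm (y - x))\<^sup>2 / r x ^ m / (2 * \<epsilon>)" for \<tau> \<xi>
  proof -
    \<comment> \<open>The \<open>w\<close>-coordinate of the perturbed pair, which returns the
      variation of x and y to the variables in which the maximum was taken.\<close>
    define W where "W t = (1 / r (x + t *\<^sub>R \<xi>) ^ m) *\<^sub>R (y - x + t *\<^sub>R (\<tau> - \<xi>))" for t
    have lr: "((\<lambda>t. r (x + t *\<^sub>R \<xi>)) \<longlongrightarrow> r x) (nhds 0)"
      unfolding r_def by (auto intro!: tendsto_eq_intros filterlim_ident)
    have "((\<lambda>t. norm (W t)) \<longlongrightarrow> norm ((1 / r x ^ m) *\<^sub>R (y - x))) (nhds 0)"
      unfolding W_def using rx by (auto intro!: tendsto_eq_intros lr filterlim_ident)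
    also have "norm ((1 / r x ^ m) *\<^sub>R (y - x)) = norm w" using rx by (simp add: y_def)
    finally have "\<forall>\<^sub>F t in nhds 0. norm (W t) < 2 * \<epsilon> * L" using wL by (rule order_tendstoD)
    moreover have "\<forall>\<^sub>F t in nhds 0. r (x + t *\<^sub>R \<xi>) > 0" using lr rx by (rule order_tendstoD)
    ultimately have "\<forall>\<^sub>F t in nhds 0. norm (W t) < 2 * \<epsilon> * L \<and> r (x + t *\<^sub>R \<xi>) > 0" by (rule eventually_conj)
    then obtain \<delta> where \<delta>: "\<delta> > 0" "\<And>t. \<bar>t\<bar> < \<delta> \<Longrightarrow> norm (W t) < 2 * \<epsilon> * L \<and> r (x + t *\<^sub>R \<xi>) > 0"
      by (auto simp: eventually_nhds_metric dist_real_def)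
    show ?thesis
    proof (intro exI conjI allI impI)
      fix t assume t: "\<bar>t\<bar> < \<delta>"
      let ?x = "x + t *\<^sub>R \<xi>"
      have rt: "r ?x > 0" "norm (W t) < 2 * \<epsilon> * L" using \<delta>(2)[OF t] by auto
      have "?x \<in> ?B" using rt(1) by (simp add: inB r_pos less_imp_le del: mem_cball)
      from max[OF this less_imp_le[OF rt(2)]] have "\<Psi> (?x, W t) \<le> \<Psi> (x, w)" .
      moreover have "?x + (r ?x ^ m) *\<^sub>R W t = y + t *\<^sub>R \<tau>" using rt(1) by (simp add: W_def algebra_simps)
      moreover have "r ?x ^ m * (norm (W t))\<^sup>2 / (2 * \<epsilon>) = (norm (y - x + t *\<^sub>R (\<tau> - \<xi>)))\<^sup>2 / r ?x ^ m / (2 * \<epsilon>)"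
        using rt(1) by (simp add: W_def power_mult_distrib power_divide power2_eq_square)
      ultimately show "u (y + t *\<^sub>R \<tau>) - u ?x - (norm (y - x + t *\<^sub>R (\<tau> - \<xi>)))\<^sup>2 / r ?x ^ m / (2 * \<epsilon>)
          \<le> u y - u x - (norm (y - x))\<^sup>2 / r x ^ m / (2 * \<epsilon>)"
        by (simp add: \<Psi>_def pen y_def[symmetric])
    qed (rule \<delta>)
  qed
  define P where "P = norm (y - x) / (\<epsilon> * r x ^ m)"
  have P: "P > 0" using \<open>w \<noteq> 0\<close> rx \<epsilon>(1) by (simp add: P_def ne)
  note dm = doubling_at_max[OF \<Omega> u x\<Omega> y\<Omega> xR \<epsilon>(1) locmax[unfolded r_def m_def],
      folded r_def m_def, folded P_def]
  have yx: "y \<noteq> x" using \<open>w \<noteq> 0\<close> rx by (simp add: y_def)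
  have gy: "grad u y = P *\<^sub>R sgn (y - x)"
    using yx \<epsilon>(1) rx by (simp add: dm(1) P_def sgn_div_norm)
  have n: "norm (sgn (y - x)) = 1" using \<open>w \<noteq> 0\<close> rx by (simp add: norm_sgn y_def)
  have PL: "P \<le> L" using L(1)[OF yB] P by (simp add: gy n)
  define \<Theta> where "\<Theta> = m * R * r x ^ (j + 1) * P"
  have gx: "norm (grad u x - grad u y) \<le> \<epsilon> * \<Theta> * P"
  proof -
    have "norm (grad u x - grad u y) = m * \<epsilon> * P\<^sup>2 * r x ^ (j + 1) * norm (x - x0)"
      using \<epsilon>(1) rx by (simp add: dm(2))
    also have "\<dots> \<le> m * \<epsilon> * P\<^sup>2 * r x ^ (j + 1) * R"
      using \<epsilon>(1) rx xR by (intro mult_left_mono) auto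
    finally show ?thesis by (simp add: \<Theta>_def power2_eq_square algebra_simps)
  qed
  have small: "\<epsilon> * \<Theta> \<le> 1 / 2"
  proof -
    have "\<Theta> \<le> m * R * (R\<^sup>2) ^ (j + 1) * L"
      unfolding \<Theta>_def using rx r_le[of x] R PL P by (intro mult_mono power_mono) auto
    also have "\<dots> = m * L * R ^ (2 * j + 3)"
      unfolding Rj by (simp only: ac_simps)
    finally have "\<epsilon> * \<Theta> \<le> \<epsilon> * (m * L * R ^ (2 * j + 3))" using \<epsilon>(1) by simp
    then show ?thesis using \<epsilon>(2) by simp
  qed
  have "\<epsilon> * \<Theta> * P \<le> P / 2" using mult_right_mono[OF small, of P] P by simp
  then have gxnz: "grad u x \<noteq> 0" using gx P n by (auto simp: gy)
  have "sgn (grad u y) = sgn (y - x)"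
    unfolding gy sgn_div_norm[of "P *\<^sub>R sgn (y - x)"] using P n by simp
  then have gynz: "grad u y \<noteq> 0" "sgn (grad u y) = sgn (y - x)" "norm (grad u y) = P"
    using P n by (auto simp: gy)
  have core: "r x * P powr (s - 1) \<le> doubling_const DIM('a) k s m * R"
    unfolding m_def
    by (rule doubling_core_estimate[OF linear_hess linear_hess s P \<epsilon>(1) rx R gy n \<Theta>_def[unfolded m_def] gx small])
      (use dm(3) pde[OF y\<Omega> gynz(1)] pde[OF x\<Omega> gxnz] gynz in \<open>auto simp: m_def\<close>)
  define C where "C = doubling_const DIM('a) k s m * R"
  have C: "C > 0" using R doubling_const_pos by (simp add: C_def)
  define \<alpha> where "\<alpha> = 2 / (s - 1)"
  have \<alpha>: "\<alpha> > 0" "\<alpha> \<le> m" using s m by (auto simp: \<alpha>_def)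
  have rP: "r x ^ m * P\<^sup>2 \<le> C powr \<alpha> * (R\<^sup>2) powr (m - \<alpha>)"
  proof -
    \<comment> \<open>Since (s - 1) \<alpha> = 2, this expresses the quantity through the controlled
      product \<open>r x * P powr (s - 1)\<close>. The remaining exponent
      \<open>m - \<alpha>\<close> is nonnegative by the choice of \<open>m\<close>, so
      \<open>r x\<close> may be replaced by its bound.\<close>
    have "r x ^ m * P\<^sup>2 = (r x * P powr (s - 1)) powr \<alpha> * r x powr (m - \<alpha>)"
    proof -
      have "(P powr (s - 1)) powr \<alpha> = P\<^sup>2"
      proof -
        have "s - 1 \<noteq> 0" using s by simp
        then have "(s - 1) * \<alpha> = 2"
          unfolding \<alpha>_def by (metis times_divide_eq_right nonzero_mult_div_cancel_left)
        then show ?thesis using P by (simp add: powr_powr)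
      qed
      moreover have "r x powr \<alpha> * r x powr (m - \<alpha>) = r x ^ m"
        using rx by (simp add: powr_add[symmetric] powr_realpow)
      ultimately show ?thesis
        using rx P by (simp add: powr_mult)
    qed
    also have "\<dots> \<le> C powr \<alpha> * (R\<^sup>2) powr (m - \<alpha>)"
      using core rx P \<alpha> r_le[of x] by (intro mult_mono powr_mono2) (auto simp: C_def)
    finally show ?thesis .
  qed
  have ne': "norm (y - x) = \<epsilon> * r x ^ m * P" using rx \<epsilon>(1) by (simp add: P_def)
  have up: "\<Psi> (x, w) \<le> \<epsilon> * (r x ^ m * P\<^sup>2) / 2 + H * (\<epsilon> * r x ^ m * P)\<^sup>2"
  proof -
    obtain z where z: "z \<in> ?B" "u y - u x = grad u z \<bullet> (y - x)" "norm (z - y) \<le> norm (y - x)"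
      using mean_value_grad[OF u convex_cball ball xw(1) yB] by metis
    have "norm (grad u z) \<le> P + H * norm (y - x)"
      using grad_lipschitz[OF u ball convex_cball H(1) z(1) yB] mult_left_mono[OF z(3) H(2)]
        norm_triangle_ineq[of "grad u y" "grad u z - grad u y"] gynz(3) by simp
    then have "u y - u x \<le> (P + H * norm (y - x)) * norm (y - x)"
      using Cauchy_Schwarz_ineq2[of "grad u z" "y - x"] z(2) by (smt (verit) mult_right_mono norm_ge_zero)
    moreover have "\<Psi> (x, w) = u y - u x - \<epsilon> * (r x ^ m * P\<^sup>2) / 2"
      unfolding \<Psi>_def using rx \<epsilon>(1) by (simp add: pen ne' y_def[symmetric]) (simp add: field_simps power2_eq_square)
    ultimately show ?thesis by (simp add: ne' power2_eq_square algebra_simps)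
  qed
  have "H * (\<epsilon> * r x ^ m * P)\<^sup>2 \<le> H * (\<epsilon> * Z * L)\<^sup>2"
    using rm_le[OF xw(1)] PL P H(2) \<epsilon>(1) rx Z by (intro mult_left_mono power_mono mult_mono) auto
  moreover have "\<epsilon> * (r x ^ m * P\<^sup>2) / 2 \<le> \<epsilon> * (C powr \<alpha> * (R\<^sup>2) powr (m - \<alpha>)) / 2"
    using rP \<epsilon>(1) by (intro divide_right_mono mult_left_mono) auto
  moreover have "H * \<epsilon> * Z * (\<epsilon> * Z * (norm g0)\<^sup>2) \<le> H * \<epsilon> * Z * (\<epsilon> * Z * L\<^sup>2)"
    using g0 H(2) \<epsilon>(1) Z by (intro mult_left_mono power_mono) auto
  \<comment> \<open>The errors at the centre and at the maximum point are each at most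
    \<open>H * (\<epsilon> * Z * L)\<^sup>2\<close>; dividing their sum by \<epsilon> / 2 gives the
    factor 4.\<close>
  ultimately have "\<epsilon> * Z * (norm g0)\<^sup>2 / 2 \<le>
      \<epsilon> * (C powr \<alpha> * (R\<^sup>2) powr (m - \<alpha>)) / 2 + 2 * (H * (\<epsilon> * Z * L)\<^sup>2)"
    using centre up by (simp add: power2_eq_square algebra_simps)
  then have "(\<epsilon> / 2) * (Z * (norm g0)\<^sup>2) \<le> (\<epsilon> / 2) * (C powr \<alpha> * (R\<^sup>2) powr (m - \<alpha>) + 4 * H * \<epsilon> * Z\<^sup>2 * L\<^sup>2)"
    by (simp add: power2_eq_square algebra_simps)
  then have "Z * (norm g0)\<^sup>2 \<le> C powr \<alpha> * (R\<^sup>2) powr (m - \<alpha>) + 4 * H * \<epsilon> * Z\<^sup>2 * L\<^sup>2"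
    using \<epsilon>(1) by (subst (asm) mult_le_cancel_left_pos) auto
  then show ?thesis by (simp only: Z_def g0_def C_def \<alpha>_def)
qed

text \<open>Letting \<epsilon> tend to 0 removes \<open>L\<close> and \<open>H\<close>. Counting
  powers of R gives |grad u|^2 \<le> c^\<alpha> R^(-\<alpha>) with \<alpha> = 2 / (q + 1 - p), and a
  square root finishes.\<close>

lemma gradient_estimate:
  fixes p q :: real
  assumes pq: "q > p - 1" "p - 1 > 0"
  obtains C where "C > 0"
    "\<And>\<Omega> (u :: 'a::euclidean_space \<Rightarrow> real) x R. \<lbrakk>open \<Omega>; Ck_on 2 u \<Omega>; distributional_solution p q \<Omega> u;
      R > 0; cball x R \<subseteq> \<Omega>\<rbrakk> \<Longrightarrow> norm (grad u x) \<le> C * R powr (- (1 / (q + 1 - p)))"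
proof
  define s where "s = q - p + 2"
  define k where "k = sqrt (p - 1)"
  define \<alpha> where "\<alpha> = 2 / (s - 1)"
  have s: "s > 1" using pq by (simp add: s_def)
  have k: "k\<^sup>2 - 1 = p - 2" using pq by (simp add: k_def)
  have \<alpha>: "\<alpha> > 0" using s by (simp add: \<alpha>_def)
  \<comment> \<open>Rounding \<alpha> up yields a natural exponent m = j + 2 \<ge> \<alpha> for the
    weight; the extra 2 leaves r^j = r^(m-2) a genuine power.\<close>
  define j where "j = nat \<lceil>\<alpha>\<rceil>"
  define m where "m = j + 2"
  have m: "2 / (s - 1) \<le> real (j + 2)" using \<alpha> by (simp add: j_def \<alpha>_def[symmetric]) linarith
  define c where "c = doubling_const DIM('a) k s m"
  have c: "c > 0" by (simp add: c_def doubling_const_pos)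
  show "c powr (\<alpha> / 2) > 0" using c by simp
  fix \<Omega> and u :: "'a \<Rightarrow> real" and x0 :: 'a and R :: real
  assume \<Omega>: "open \<Omega>" and u: "Ck_on 2 u \<Omega>" and sol: "distributional_solution p q \<Omega> u"
    and R: "R > 0" and ball: "cball x0 R \<subseteq> \<Omega>"
  have pde: "(\<Sum>b\<in>Basis. hess u z b \<bullet> b) + (k\<^sup>2 - 1) * (hess u z (sgn (grad u z)) \<bullet> sgn (grad u z)) = norm (grad u z) powr s"
    if "z \<in> \<Omega>" "grad u z \<noteq> 0" for z
    unfolding k s_def by (rule pde_pointwise[OF \<Omega> u sol that])
  show "norm (grad u x0) \<le> c powr (\<alpha> / 2) * R powr (- (1 / (q + 1 - p)))"
  proof (cases "grad u x0 = 0")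
    case False
    have "bounded (grad u ` cball x0 R)"
      by (intro compact_imp_bounded compact_continuous_image compact_cball
          continuous_on_subset[OF continuous_on_grad[OF u] ball])
    then obtain L where L: "L > 0" "\<And>z. z \<in> cball x0 R \<Longrightarrow> norm (grad u z) \<le> L"
      unfolding bounded_pos by blast
    obtain H where H: "H \<ge> 0" "\<And>z h. z \<in> cball x0 R \<Longrightarrow> norm (hess u z h) \<le> H * norm h"
      using hess_bound[OF u compact_cball ball] by metis
    let ?S = "(c * R) powr \<alpha> * (R\<^sup>2) powr (m - \<alpha>)"
    let ?f = "\<lambda>\<epsilon>. ?S + 4 * H * \<epsilon> * (R ^ (2 * m))\<^sup>2 * L\<^sup>2"
    have "\<forall>\<^sub>F \<epsilon> in at_right 0. R ^ (2 * m) * (norm (grad u x0))\<^sup>2 \<le> ?f \<epsilon>"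
    proof -
      have "((\<lambda>\<epsilon>. \<epsilon> * (4 * m * L * R ^ (2 * j + 3))) \<longlongrightarrow> 0) (at_right 0)"
        "((\<lambda>\<epsilon>. 2 * H * \<epsilon> * R ^ (2 * m)) \<longlongrightarrow> 0) (at_right (0::real))"
        by (auto intro!: tendsto_eq_intros)
      then have "\<forall>\<^sub>F \<epsilon> in at_right 0. \<epsilon> * (4 * m * L * R ^ (2 * j + 3)) < 1"
        "\<forall>\<^sub>F \<epsilon> in at_right 0. 2 * H * \<epsilon> * R ^ (2 * m) < 1"
        by (auto intro: order_tendstoD(2))
      moreover have "\<forall>\<^sub>F \<epsilon> in at_right (0::real). \<epsilon> > 0" by (rule eventually_at_right_less)
      ultimately show ?thesis
      proof eventually_elim
        case (elim \<epsilon>)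
        show ?case
          unfolding c_def m_def \<alpha>_def
          by (rule grad_estimate_penalised[OF \<Omega> u pde s R ball m L(2,1) H(2,1) elim(3) elim(1,2)[unfolded m_def] False])
      qed
    qed
    moreover have "(?f \<longlongrightarrow> ?S) (at_right 0)"
      by (auto intro!: tendsto_eq_intros)
    ultimately have "R ^ (2 * m) * (norm (grad u x0))\<^sup>2 \<le> ?S"
      by (intro tendsto_lowerbound[of ?f ?S "at_right 0"]) auto
    also have "?S = R ^ (2 * m) * (c powr \<alpha> * R powr (- \<alpha>))"
    proof -
      have "(R\<^sup>2) powr (m - \<alpha>) = R powr (2 * m - 2 * \<alpha>)"
        using R powr_powr[of R 2 "m - \<alpha>"] by (simp add: right_diff_distrib)
      then have "?S = c powr \<alpha> * (R powr \<alpha> * R powr (2 * m - 2 * \<alpha>))"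
        using c R by (simp add: powr_mult)
      also have "R powr \<alpha> * R powr (2 * m - 2 * \<alpha>) = R powr (real (2 * m) + - \<alpha>)"
        by (simp only: powr_add[symmetric]) simp
      also have "\<dots> = R ^ (2 * m) * R powr (- \<alpha>)"
        using R by (simp only: powr_add powr_realpow)
      finally show ?thesis by simp
    qed
    finally have "(norm (grad u x0))\<^sup>2 \<le> c powr \<alpha> * R powr (- \<alpha>)"
      using R by (subst (asm) mult_le_cancel_left_pos) auto
    also have "\<dots> = (c powr (\<alpha> / 2) * R powr (- (\<alpha> / 2)))\<^sup>2"
      using c R powr_add[of c "\<alpha> / 2" "\<alpha> / 2"] powr_add[of R "- (\<alpha> / 2)" "- (\<alpha> / 2)"]
      by (simp add: power2_eq_square)
    finally have "norm (grad u x0) \<le> c powr (\<alpha> / 2) * R powr (- (\<alpha> / 2))"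
      by (rule power2_le_imp_le) simp
    moreover have "\<alpha> / 2 = 1 / (s - 1)" using s by (simp add: \<alpha>_def field_simps)
    moreover have "s - 1 = q + 1 - p" by (simp add: s_def)
    ultimately show ?thesis by (simp only:)
  qed simp
qed

section \<open>Geometry near the boundary\<close>

text \<open>A ball is connected, so if it left \<open>\<Omega>\<close> it would contain a frontier
  point closer to \<open>x\<close> than the distance to the frontier.\<close>

lemma ball_bdist_subset:
  assumes "x \<in> \<Omega>"
  shows "ball x (bdist \<Omega> x) \<subseteq> \<Omega>"
proof (rule ccontr)
  assume "\<not> ?thesis"
  then have "ball x (bdist \<Omega> x) - \<Omega> \<noteq> {}" by blast
  moreover have "x \<in> ball x (bdist \<Omega> x)"
    using calculation by (metis Diff_empty ball_eq_empty centre_in_ball empty_Diff not_le)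
  then have "ball x (bdist \<Omega> x) \<inter> \<Omega> \<noteq> {}" using assms by blast
  ultimately obtain z where "z \<in> ball x (bdist \<Omega> x)" "z \<in> frontier \<Omega>"
    using connected_Int_frontier[OF connected_ball] by blast
  then show False using infdist_le[of z "frontier \<Omega>" x] by simp
qed

lemma le_bdist:
  assumes "open \<Omega>" "frontier \<Omega> \<noteq> {}" "ball x \<rho> \<subseteq> \<Omega>"
  shows "\<rho> \<le> bdist \<Omega> x"
proof -
  have "\<rho> \<le> dist x z" if "z \<in> frontier \<Omega>" for z
  proof -
    have "z \<notin> \<Omega>" using that assms(1) by (simp add: frontier_def interior_open)
    then show ?thesis using assms(3) by (metis mem_ball not_le subsetD)
  qed
  then show ?thesis
    using assms(2) by (auto simp: infdist_notempty intro: cINF_greatest)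
qed

lemma bdist_pos:
  assumes "open \<Omega>" "frontier \<Omega> \<noteq> {}" "x \<in> \<Omega>"
  shows "bdist \<Omega> x > 0"
  by (rule infdist_pos_not_in_closed)
    (use assms in \<open>auto simp: frontier_def interior_open\<close>)

lemma frontier_nonempty:
  fixes \<Omega> :: "'a::euclidean_space set"
  assumes "bounded \<Omega>" "\<Omega> \<noteq> {}"
  shows "frontier \<Omega> \<noteq> {}"
  using assms not_bounded_UNIV by (auto simp: frontier_eq_empty)

text \<open>The defining function f of the epigraph increases along a cone of directions around its
  normalised gradient n at \<open>x0\<close>. Translating the inscribed ball by t n therefore leaves
  room to enlarge its radius by t / 2: each new point is a point of the old ball plus a vector of
  the cone.\<close>

lemma C2_boundary_inward_direction:
  fixes \<Omega> :: "'a::euclidean_space set"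
  assumes \<Omega>: "open \<Omega>" and C2: "C2_boundary \<Omega>" and x0: "x0 \<in> frontier \<Omega>"
  obtains \<rho> n where "\<rho> > 0" "norm n = 1"
    "\<And>x t. x \<in> \<Omega> \<Longrightarrow> x \<in> ball x0 \<rho> \<Longrightarrow> 0 \<le> t \<Longrightarrow> t \<le> \<rho> \<Longrightarrow>
       x + t *\<^sub>R n \<in> \<Omega> \<and> bdist \<Omega> x + t / 2 \<le> bdist \<Omega> (x + t *\<^sub>R n)"
proof -
  have fr: "frontier \<Omega> \<noteq> {}" using x0 by blast
  obtain r \<nu> \<gamma> where r: "r > 0" and \<nu>: "norm \<nu> = 1" and \<gamma>: "Ck_on 2 \<gamma> UNIV"
    and epi: "\<Omega> \<inter> ball x0 r = {x \<in> ball x0 r. x \<bullet> \<nu> > \<gamma> (x - (x \<bullet> \<nu>) *\<^sub>R \<nu>)}"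
    using C2 x0 unfolding C2_boundary_def by blast
  define f where "f z = z \<bullet> \<nu> - \<gamma> (z - (z \<bullet> \<nu>) *\<^sub>R \<nu>)" for z
  \<comment> \<open>The gradient of \<open>f\<close>: \<nu> minus the tangential part of the
    gradient of \<gamma>.\<close>
  define F where "F z = (let g = grad \<gamma> (z - (z \<bullet> \<nu>) *\<^sub>R \<nu>) in \<nu> - (g - (g \<bullet> \<nu>) *\<^sub>R \<nu>))" for z
  have mem: "z \<in> \<Omega> \<longleftrightarrow> f z > 0" if "z \<in> ball x0 r" for z
    using epi that by (auto simp: f_def set_eq_iff)
  have der: "(f has_derivative (\<lambda>h. F z \<bullet> h)) (at z)" for z
  proof -
    have Q: "((\<lambda>z. z - (z \<bullet> \<nu>) *\<^sub>R \<nu>) has_derivative (\<lambda>h. h - (h \<bullet> \<nu>) *\<^sub>R \<nu>)) (at z)"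
      by (auto intro!: derivative_eq_intros)
    have "((\<lambda>z. \<gamma> (z - (z \<bullet> \<nu>) *\<^sub>R \<nu>)) has_derivative
        (\<lambda>h. grad \<gamma> (z - (z \<bullet> \<nu>) *\<^sub>R \<nu>) \<bullet> (h - (h \<bullet> \<nu>) *\<^sub>R \<nu>))) (at z)"
      by (rule has_derivative_compose[OF Q has_derivative_grad[OF C2_differentiable(1)[OF \<gamma> UNIV_I]]])
    then have "(f has_derivative (\<lambda>h. h \<bullet> \<nu> - grad \<gamma> (z - (z \<bullet> \<nu>) *\<^sub>R \<nu>) \<bullet> (h - (h \<bullet> \<nu>) *\<^sub>R \<nu>))) (at z)"
      unfolding f_def[abs_def]
      by (intro has_derivative_diff) (auto intro!: derivative_eq_intros)
    then show ?thesis
      by (rule has_derivative_eq_rhs)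
        (auto simp: F_def Let_def inner_diff_left inner_diff_right inner_commute)
  qed
  have contF: "continuous_on UNIV F"
    unfolding F_def[abs_def] Let_def
    by (intro continuous_intros continuous_on_compose2[OF continuous_on_grad[OF \<gamma>]]) auto
  define m where "m = F x0"
  \<comment> \<open>The subtracted part is orthogonal to the unit vector \<nu>; in particular the
    gradient of \<open>f\<close> never degenerates.\<close>
  have "m \<bullet> \<nu> = 1"
    using \<nu> by (simp add: m_def F_def Let_def inner_diff_left norm_eq_1)
  then have m: "norm m \<ge> 1" using Cauchy_Schwarz_ineq2[of m \<nu>] \<nu> by simp
  define n where "n = sgn m"
  have n: "norm n = 1" using m by (auto simp: n_def norm_sgn)
  have mn: "m \<bullet> n = norm m"
  proof -
    have "norm m \<noteq> 0" using m by linarith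
    then show ?thesis by (simp add: n_def sgn_div_norm dot_square_norm power2_eq_square)
  qed
  \<comment> \<open>Vectors e of the cone have norm at most 3 t / 2, so replacing \<open>F\<close>
    by \<open>m\<close> changes the derivative by at most 3 t / 16, less than the t / 2 gained from
    \<open>m\<close>.\<close>
  obtain r1 where r1: "r1 > 0" "\<And>z. dist z x0 < r1 \<Longrightarrow> dist (F z) m < 1 / 8"
    using contF[unfolded continuous_on_eq_continuous_at[OF open_UNIV], rule_format, OF UNIV_I, of x0]
    unfolding continuous_at_eps_delta m_def by (metis divide_pos_pos zero_less_numeral zero_less_one)
  define r2 where "r2 = min r r1"
  have r2: "r2 > 0" "r2 \<le> r" "r2 \<le> r1" using r r1 by (auto simp: r2_def)
  have cone: "z + e \<in> \<Omega>" if z: "z \<in> \<Omega>" "z \<in> ball x0 r2" "z + e \<in> ball x0 r2"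
    and e: "norm (e - t *\<^sub>R n) \<le> t / 2" "t \<ge> 0" for z e t
  proof -
    have line: "((\<lambda>s. f (z + s *\<^sub>R e)) has_real_derivative F (z + s *\<^sub>R e) \<bullet> e) (at s)" for s
    proof -
      have "((\<lambda>s. z + s *\<^sub>R e) has_derivative (\<lambda>s. s *\<^sub>R e)) (at s)"
        by (auto intro!: derivative_eq_intros)
      from has_derivative_compose[OF this der] show ?thesis
        by (rule has_derivative_imp_has_field_derivative) simp
    qed
    have "\<exists>s. 0 < s \<and> s < 1 \<and> f (z + 1 *\<^sub>R e) - f (z + 0 *\<^sub>R e) = (1 - 0) * (F (z + s *\<^sub>R e) \<bullet> e)"
      by (rule MVT2) (auto intro: line)
    then obtain s where s: "0 < s" "s < 1" "f (z + e) - f z = F (z + s *\<^sub>R e) \<bullet> e" by auto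
    have "z + s *\<^sub>R e \<in> ball x0 r2"
      using convexD_alt[OF convex_ball z(2,3), of s] s by (simp add: algebra_simps)
    then have "dist (z + s *\<^sub>R e) x0 < r1" using r2(3) by (simp add: dist_commute)
    then have "norm (F (z + s *\<^sub>R e) - m) \<le> 1 / 8"
      using r1(2) unfolding dist_norm[of "F _"] by (meson less_imp_le)
    then have 1: "\<bar>(F (z + s *\<^sub>R e) - m) \<bullet> e\<bar> \<le> 1 / 8 * norm e"
      using Cauchy_Schwarz_ineq2[of "F (z + s *\<^sub>R e) - m" e]
      by (meson mult_right_mono norm_ge_zero order_trans)
    have "norm e \<le> norm (e - t *\<^sub>R n) + norm (t *\<^sub>R n)" using norm_triangle_ineq[of "e - t *\<^sub>R n" "t *\<^sub>R n"] by simp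
    then have 2: "norm e \<le> 3 / 2 * t" using e n by simp
    have "\<bar>m \<bullet> (e - t *\<^sub>R n)\<bar> \<le> norm m * (t / 2)"
      using Cauchy_Schwarz_ineq2[of m "e - t *\<^sub>R n"] mult_left_mono[OF e(1), of "norm m"] by simp
    moreover have "m \<bullet> (e - t *\<^sub>R n) = m \<bullet> e - t * norm m" by (simp add: inner_diff_right mn)
    ultimately have "m \<bullet> e \<ge> t * norm m - norm m * (t / 2)" by linarith
    moreover have "t * norm m \<ge> t" using m e(2) by (simp add: mult_le_cancel_left1)
    ultimately have "m \<bullet> e \<ge> t / 2" by (simp add: algebra_simps)
    then have "F (z + s *\<^sub>R e) \<bullet> e \<ge> 0"
      using 1 2 e(2) unfolding inner_diff_left by linarith
    moreover have "f z > 0" using mem z r2 by auto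
    ultimately have "f (z + e) > 0" using s by simp
    then show ?thesis using mem[of "z + e"] z r2 by auto
  qed
  show ?thesis
  \<comment> \<open>An eighth leaves room: |x - x0|, \<open>d\<close> and \<open>t\<close> are each
    at most r2 / 8, and all points used are within d + 3 t / 2 of \<open>x\<close>, so they stay in
    \<open>ball x0 r2\<close>.\<close>
  proof (rule that[of "r2 / 8" n])
    show "r2 / 8 > 0" "norm n = 1" using r2 n by auto
    fix x t assume x: "x \<in> \<Omega>" "x \<in> ball x0 (r2 / 8)" and t: "0 \<le> t" "t \<le> r2 / 8"
    define d where "d = bdist \<Omega> x"
    have d: "d > 0" unfolding d_def by (rule bdist_pos[OF \<Omega> fr x(1)])
    have d_le: "d \<le> dist x x0" unfolding d_def by (rule infdist_le[OF x0])
    have sub: "ball (x + t *\<^sub>R n) (d + t / 2) \<subseteq> \<Omega>"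
    proof
      fix y assume y: "y \<in> ball (x + t *\<^sub>R n) (d + t / 2)"
      define v where "v = y - (x + t *\<^sub>R n)"
      have v: "norm v < d + t / 2" using y by (simp add: v_def dist_norm norm_minus_commute)
      \<comment> \<open>Splits \<open>v\<close> into a part shorter than \<open>d\<close>, which
        stays in the old ball, and a rest of length at most t / 2, which fits into the cone around t
        n.\<close>
      define \<theta> where "\<theta> = d / (d + t / 2)"
      have \<theta>: "0 < \<theta>" "\<theta> \<le> 1" "\<theta> * (d + t / 2) = d" "(1 - \<theta>) * (d + t / 2) = t / 2"
        using d t by (auto simp: \<theta>_def field_simps)
      have a: "norm (\<theta> *\<^sub>R v) < d"
        using mult_strict_left_mono[OF v \<theta>(1)] \<theta> by simp
      have b: "norm ((1 - \<theta>) *\<^sub>R v) \<le> t / 2"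
        using mult_left_mono[OF less_imp_le[OF v], of "1 - \<theta>"] \<theta> by simp
      have z: "x + \<theta> *\<^sub>R v \<in> ball x d" using a by (simp add: dist_norm)
      then have z\<Omega>: "x + \<theta> *\<^sub>R v \<in> \<Omega>" using ball_bdist_subset[OF x(1)] by (auto simp: d_def)
      have "dist x0 (x + \<theta> *\<^sub>R v) < r2"
        using dist_triangle[of x0 "x + \<theta> *\<^sub>R v" x] z d_le x(2) r2(1) by (simp add: dist_commute)
      moreover have "dist x0 y < r2"
      proof -
        have "dist x0 y \<le> dist x0 x + dist x y" by (rule dist_triangle)
        also have "dist x y = norm (v + t *\<^sub>R n)" by (simp add: v_def dist_norm norm_minus_commute)
        also have "\<dots> \<le> norm v + t" using norm_triangle_ineq[of v "t *\<^sub>R n"] n t by simp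
        finally show ?thesis using v t d_le x(2) r2(1) by (simp add: dist_commute)
      qed
      moreover have y_eq: "y = (x + \<theta> *\<^sub>R v) + (t *\<^sub>R n + (1 - \<theta>) *\<^sub>R v)"
        by (simp add: v_def algebra_simps)
      ultimately show "y \<in> \<Omega>"
        using cone[OF z\<Omega>, of "t *\<^sub>R n + (1 - \<theta>) *\<^sub>R v" t] b t(1) by simp
    qed
    have "x + t *\<^sub>R n \<in> ball (x + t *\<^sub>R n) (d + t / 2)" using d t by simp
    then show "x + t *\<^sub>R n \<in> \<Omega> \<and> bdist \<Omega> x + t / 2 \<le> bdist \<Omega> (x + t *\<^sub>R n)"
      using sub le_bdist[OF \<Omega> fr sub] by (auto simp: d_def)
  qed
qed

text \<open>Compactness of the frontier makes the local directions uniform, and the guaranteed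
  growth rate 1/2 lets the intermediate value theorem stop exactly at the level.\<close>

lemma C2_boundary_paths_to_level:
  fixes \<Omega> :: "'a::euclidean_space set"
  assumes \<Omega>: "open \<Omega>" "bounded \<Omega>" "\<Omega> \<noteq> {}" and C2: "C2_boundary \<Omega>"
  obtains \<delta> where "\<delta> > 0"
    "\<And>x. x \<in> \<Omega> \<Longrightarrow> bdist \<Omega> x \<le> \<delta> \<Longrightarrow> \<exists>n T. norm n = 1 \<and> T \<ge> 0 \<and> bdist \<Omega> (x + T *\<^sub>R n) = \<delta> \<and>
       (\<forall>t. 0 \<le> t \<longrightarrow> t \<le> T \<longrightarrow> x + t *\<^sub>R n \<in> \<Omega> \<and> bdist \<Omega> x + t / 2 \<le> bdist \<Omega> (x + t *\<^sub>R n))"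
proof -
  have fr: "frontier \<Omega> \<noteq> {}" by (rule frontier_nonempty[OF \<Omega>(2,3)])
  define good where "good n \<rho> x0 \<longleftrightarrow> \<rho> > 0 \<and> norm n = 1 \<and> (\<forall>x t. x \<in> \<Omega> \<longrightarrow> x \<in> ball x0 \<rho> \<longrightarrow> 0 \<le> t \<longrightarrow> t \<le> \<rho> \<longrightarrow>
       x + t *\<^sub>R n \<in> \<Omega> \<and> bdist \<Omega> x + t / 2 \<le> bdist \<Omega> (x + t *\<^sub>R n))" for n :: 'a and \<rho> x0
  have ex: "\<exists>n \<rho>. good n \<rho> x0" if "x0 \<in> frontier \<Omega>" for x0
    using C2_boundary_inward_direction[OF \<Omega>(1) C2 that] unfolding good_def by metis
  define \<G> where "\<G> = {ball x0 \<rho> |x0 \<rho>. \<exists>n. good n \<rho> x0}"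
  have "compact (frontier \<Omega>)" using \<Omega>(2) by (simp add: compact_frontier_bounded)
  moreover have "frontier \<Omega> \<subseteq> \<Union>\<G>"
  proof
    fix z assume "z \<in> frontier \<Omega>"
    then obtain n \<rho> where "good n \<rho> z" using ex by blast
    then have "ball z \<rho> \<in> \<G>" "z \<in> ball z \<rho>" by (auto simp: \<G>_def good_def)
    then show "z \<in> \<Union>\<G>" by blast
  qed
  moreover have "open G" if "G \<in> \<G>" for G using that by (auto simp: \<G>_def)
  \<comment> \<open>A Lebesgue number of the cover of the frontier by balls that share one inward
    direction.\<close>
  ultimately have "\<exists>e>0. \<forall>z\<in>frontier \<Omega>. \<exists>G\<in>\<G>. ball z e \<subseteq> G"
    by (rule Heine_Borel_lemma) blast+
  then obtain e where e: "e > 0" "\<And>z. z \<in> frontier \<Omega> \<Longrightarrow> \<exists>G\<in>\<G>. ball z e \<subseteq> G" by blast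
  show ?thesis
  proof (rule that[of "e / 2"])
    show "e / 2 > 0" using e by simp
    fix x assume x: "x \<in> \<Omega>" "bdist \<Omega> x \<le> e / 2"
    obtain z where z: "z \<in> frontier \<Omega>" "bdist \<Omega> x = dist x z"
      using infdist_attains_inf[OF frontier_closed fr] by metis
    obtain x0 \<rho> n where g: "good n \<rho> x0" "ball z e \<subseteq> ball x0 \<rho>"
      using e(2)[OF z(1)] by (auto simp: \<G>_def)
    have "x \<in> ball z e" using z x(2) e(1) by (simp add: dist_commute)
    then have xb: "x \<in> ball x0 \<rho>" using g(2) by blast
    have "e \<le> \<rho>" using g(2) e(1) by (simp add: ball_subset_ball_iff) (smt (verit) zero_le_dist)
    then have path: "x + t *\<^sub>R n \<in> \<Omega> \<and> bdist \<Omega> x + t / 2 \<le> bdist \<Omega> (x + t *\<^sub>R n)" if "0 \<le> t" "t \<le> e" for t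
      using g(1) x(1) xb that unfolding good_def by auto
    \<comment> \<open>The length after which growth at rate 1/2 must have reached the level e / 2.
      It is at most \<open>e\<close>, hence at most the admissible length
      \<open>\<rho>\<close>.\<close>
    define S where "S = 2 * (e / 2 - bdist \<Omega> x)"
    have S: "0 \<le> S" "S \<le> e" using x(2) infdist_nonneg[of x "frontier \<Omega>"] by (auto simp: S_def)
    have "continuous_on {0..S} (\<lambda>t. bdist \<Omega> (x + t *\<^sub>R n))" by (intro continuous_intros)
    moreover have "e / 2 \<le> bdist \<Omega> (x + S *\<^sub>R n)" using path[OF S] unfolding S_def by argo
    ultimately obtain T where T: "0 \<le> T" "T \<le> S" "bdist \<Omega> (x + T *\<^sub>R n) = e / 2"
      using IVT'[of "\<lambda>t. bdist \<Omega> (x + t *\<^sub>R n)" 0 "e / 2" S] x(2) S(1) by auto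
    show "\<exists>n T. norm n = 1 \<and> T \<ge> 0 \<and> bdist \<Omega> (x + T *\<^sub>R n) = e / 2 \<and>
       (\<forall>t. 0 \<le> t \<longrightarrow> t \<le> T \<longrightarrow> x + t *\<^sub>R n \<in> \<Omega> \<and> bdist \<Omega> x + t / 2 \<le> bdist \<Omega> (x + t *\<^sub>R n))"
      using T S path g(1) by (intro exI[of _ n] exI[of _ T]) (auto simp: good_def)
  qed
qed

text \<open>As \<delta> is positive, the level set does not touch the frontier, so it is closed in
  the compact closure of \<open>\<Omega>\<close>; the maximum is attained and
  \<open>GREATEST\<close> denotes it.\<close>

lemma abs_le_level_max:
  fixes \<Omega> :: "'a::euclidean_space set"
  assumes \<Omega>: "open \<Omega>" "bounded \<Omega>" and u: "continuous_on \<Omega> u" and z: "z \<in> \<Omega>" "bdist \<Omega> z = \<delta>" and \<delta>: "\<delta> > 0"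
  shows "\<bar>u z\<bar> \<le> level_max \<Omega> u \<delta>"
proof -
  define S where "S = {z\<in>\<Omega>. bdist \<Omega> z = \<delta>}"
  have "S = closure \<Omega> \<inter> {z. bdist \<Omega> z = \<delta>}"
    using \<delta> closure_subset[of \<Omega>] \<Omega>(1) by (auto simp: S_def frontier_def interior_open intro: ccontr)
  moreover have "closed {z. bdist \<Omega> z = \<delta>}"
    by (intro closed_Collect_eq continuous_intros)
  moreover have "compact (closure \<Omega>)" using \<Omega>(2) by (simp add: compact_closure)
  ultimately have "compact S" by (simp add: compact_Int_closed)
  moreover have "continuous_on S (\<lambda>z. \<bar>u z\<bar>)"
    by (intro continuous_intros continuous_on_subset[OF u]) (auto simp: S_def)
  moreover have zS: "z \<in> S" using z by (simp add: S_def)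
  ultimately obtain y where y: "y \<in> S" "\<And>z. z \<in> S \<Longrightarrow> \<bar>u z\<bar> \<le> \<bar>u y\<bar>"
    using continuous_attains_sup[of S "\<lambda>z. \<bar>u z\<bar>"] by blast
  have "level_max \<Omega> u \<delta> = \<bar>u y\<bar>"
    unfolding level_max_def
    by (rule Greatest_equality) (use y in \<open>auto simp: S_def\<close>)
  then show ?thesis using y(2)[OF zS] by simp
qed

section \<open>The boundary estimate\<close>

lemma abs_increment_le_of_derivative_bound:
  fixes f f' G G' :: "real \<Rightarrow> real"
  assumes T: "0 \<le> T"
    and f: "\<And>t. 0 \<le> t \<Longrightarrow> t \<le> T \<Longrightarrow> (f has_real_derivative f' t) (at t)"
    and G: "\<And>t. 0 \<le> t \<Longrightarrow> t \<le> T \<Longrightarrow> (G has_real_derivative G' t) (at t)"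
    and le: "\<And>t. 0 \<le> t \<Longrightarrow> t \<le> T \<Longrightarrow> \<bar>f' t\<bar> \<le> G' t"
  shows "\<bar>f T - f 0\<bar> \<le> G T - G 0"
proof -
  have "f T - G T \<le> f 0 - G 0"
  proof (rule DERIV_nonpos_imp_nonincreasing[OF T, of "\<lambda>t. f t - G t"])
    fix t assume t: "0 \<le> t" "t \<le> T"
    show "\<exists>y. ((\<lambda>t. f t - G t) has_real_derivative y) (at t) \<and> y \<le> 0"
      using DERIV_diff[OF f[OF t] G[OF t]] le[OF t] by (intro exI[of _ "f' t - G' t"]) (simp add: abs_le_iff)
  qed
  moreover have "f 0 + G 0 \<le> f T + G T"
  proof (rule DERIV_nonneg_imp_nondecreasing[OF T, of "\<lambda>t. f t + G t"])
    fix t assume t: "0 \<le> t" "t \<le> T"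
    show "\<exists>y. ((\<lambda>t. f t + G t) has_real_derivative y) (at t) \<and> 0 \<le> y"
      using DERIV_add[OF f[OF t] G[OF t]] le[OF t] by (intro exI[of _ "f' t + G' t"]) (simp add: abs_le_iff)
  qed
  ultimately show ?thesis by linarith
qed

text \<open>An arbitrary antiderivative \<open>G\<close> of the gradient bound treats the power and
  the logarithm at once. \<open>C\<close> is chosen before \<open>\<Omega>\<close>, and \<delta>
  before \<open>u\<close>, from the geometry alone. The comparison of the values of \<open>G\<close>
  is recorded because it later fixes the sign inside the absolute value.\<close>

lemma boundary_estimate:
  fixes p q :: real
  assumes pq: "q > p - 1" "p - 1 > 0"
  shows "\<exists>C>0. \<forall>\<Omega> :: 'a::euclidean_space set.
      open \<Omega> \<longrightarrow> bounded \<Omega> \<longrightarrow> \<Omega> \<noteq> {} \<longrightarrow> C2_boundary \<Omega> \<longrightarrow>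
      (\<exists>\<delta>>0. (\<exists>z\<in>\<Omega>. bdist \<Omega> z = \<delta>) \<and>
        (\<forall>u. Ck_on 2 u \<Omega> \<longrightarrow> distributional_solution p q \<Omega> u \<longrightarrow>
          (\<forall>G. (\<forall>s>0. (G has_real_derivative s powr (- (1 / (q + 1 - p)))) (at s)) \<longrightarrow>
            (\<forall>x\<in>{z\<in>\<Omega>. bdist \<Omega> z \<le> \<delta>}. G (bdist \<Omega> x) \<le> G \<delta> \<and>
               \<bar>u x\<bar> \<le> C * (G \<delta> - G (bdist \<Omega> x)) + level_max \<Omega> u \<delta>))))"
proof -
  define a where "a = 1 / (q + 1 - p)"
  have a: "a > 0" using pq by (simp add: a_def)
  obtain C0 where C0: "C0 > 0"
    "\<And>\<Omega> (u :: 'a \<Rightarrow> real) x R. \<lbrakk>open \<Omega>; Ck_on 2 u \<Omega>; distributional_solution p q \<Omega> u;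
      R > 0; cball x R \<subseteq> \<Omega>\<rbrakk> \<Longrightarrow> norm (grad u x) \<le> C0 * R powr (- a)"
    using gradient_estimate[OF pq, where 'a = 'a] unfolding a_def by metis
  \<comment> \<open>The gradient estimate asks for a closed ball in \<open>\<Omega>\<close>, so it
    is applied with half the distance; this costs the factor (1/2)^(-a).\<close>
  define C1 where "C1 = C0 * (1 / 2) powr (- a)"
  have C1: "C1 > 0" using C0 by (simp add: C1_def)
  show ?thesis
  proof (rule exI[of _ "2 * C1"], intro conjI allI impI)
    show "2 * C1 > 0" using C1 by simp
    fix \<Omega> :: "'a set"
    assume \<Omega>: "open \<Omega>" "bounded \<Omega>" "\<Omega> \<noteq> {}" and C2: "C2_boundary \<Omega>"
    have fr: "frontier \<Omega> \<noteq> {}" by (rule frontier_nonempty[OF \<Omega>(2,3)])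
    obtain \<delta> where \<delta>: "\<delta> > 0" and path:
      "\<And>x. x \<in> \<Omega> \<Longrightarrow> bdist \<Omega> x \<le> \<delta> \<Longrightarrow> \<exists>n T. norm n = 1 \<and> T \<ge> 0 \<and> bdist \<Omega> (x + T *\<^sub>R n) = \<delta> \<and>
       (\<forall>t. 0 \<le> t \<longrightarrow> t \<le> T \<longrightarrow> x + t *\<^sub>R n \<in> \<Omega> \<and> bdist \<Omega> x + t / 2 \<le> bdist \<Omega> (x + t *\<^sub>R n))"
      using C2_boundary_paths_to_level[OF \<Omega> C2] by metis
    \<comment> \<open>The path starting at a point close to the frontier ends on the level
      set.\<close>
    have level: "\<exists>z\<in>\<Omega>. bdist \<Omega> z = \<delta>"
    proof -
      obtain z where z: "z \<in> frontier \<Omega>" using fr by blast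
      then obtain x where x: "x \<in> \<Omega>" "dist x z < \<delta>"
        using \<delta> by (auto simp: frontier_def closure_approachable)
      then have "bdist \<Omega> x \<le> \<delta>" using infdist_le[OF z, of x] by simp
      then show ?thesis using path[OF x(1)] by (metis order_refl)
    qed
    have main: "G (bdist \<Omega> x) \<le> G \<delta> \<and> \<bar>u x\<bar> \<le> 2 * C1 * (G \<delta> - G (bdist \<Omega> x)) + level_max \<Omega> u \<delta>"
      if u: "Ck_on 2 u \<Omega>" and sol: "distributional_solution p q \<Omega> u"
        and G: "\<And>s. s > 0 \<Longrightarrow> (G has_real_derivative s powr (- a)) (at s)"
        and x: "x \<in> \<Omega>" "bdist \<Omega> x \<le> \<delta>" for u G x
    proof -
      define d where "d = bdist \<Omega> x"
      have d: "d > 0" unfolding d_def by (rule bdist_pos[OF \<Omega>(1) fr x(1)])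
      have G_mono: "G s \<le> G t" if "0 < s" "s \<le> t" for s t
        by (rule DERIV_nonneg_imp_nondecreasing[OF that(2)])
          (meson G less_le_trans powr_ge_zero that(1))
      have grad_le: "norm (grad u z) \<le> C1 * s powr (- a)" if z: "z \<in> \<Omega>" "0 < s" "s \<le> bdist \<Omega> z" for z s
      proof -
        have "cball z (s / 2) \<subseteq> ball z (bdist \<Omega> z)" using z by auto
        then have "cball z (s / 2) \<subseteq> \<Omega>" using ball_bdist_subset[OF z(1)] by blast
        then have "norm (grad u z) \<le> C0 * (s / 2) powr (- a)"
          using C0(2)[OF \<Omega>(1) u sol] z(2) by simp
        also have "(s / 2) powr (- a) = (1 / 2) powr (- a) * s powr (- a)"
          using z(2) powr_mult[of "1 / 2" s "- a"] by simp
        finally show ?thesis by (simp add: C1_def mult.assoc)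
      qed
      obtain n T where n: "norm n = 1" and T: "T \<ge> 0" "bdist \<Omega> (x + T *\<^sub>R n) = \<delta>"
        and p: "\<And>t. 0 \<le> t \<Longrightarrow> t \<le> T \<Longrightarrow> x + t *\<^sub>R n \<in> \<Omega> \<and> d + t / 2 \<le> bdist \<Omega> (x + t *\<^sub>R n)"
        using path[OF x] unfolding d_def by metis
      \<comment> \<open>Along the path the distance is bounded below by d + t / 2; the inner
        derivative 1/2 is compensated by the factor 2 in front of \<open>G\<close>.\<close>
      have "\<bar>u (x + T *\<^sub>R n) - u (x + 0 *\<^sub>R n)\<bar> \<le> 2 * C1 * G (d + T / 2) - 2 * C1 * G (d + 0 / 2)"
      proof (rule abs_increment_le_of_derivative_bound[OF T(1)])
        fix t assume t: "0 \<le> t" "t \<le> T"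
        note pt = p[OF t]
        show "((\<lambda>t. u (x + t *\<^sub>R n)) has_real_derivative grad u (x + t *\<^sub>R n) \<bullet> n) (at t)"
          by (rule DERIV_along_line(1)[OF u]) (use pt in simp)
        have "((\<lambda>t. G (d + t / 2)) has_real_derivative (d + t / 2) powr (- a) * (1 / 2)) (at t)"
          by (rule DERIV_chain2[OF G]) (use d t in \<open>auto intro!: derivative_eq_intros\<close>)
        from DERIV_cmult[OF this, of "2 * C1"]
        show "((\<lambda>t. 2 * C1 * G (d + t / 2)) has_real_derivative C1 * (d + t / 2) powr (- a)) (at t)"
          by simp
        show "\<bar>grad u (x + t *\<^sub>R n) \<bullet> n\<bar> \<le> C1 * (d + t / 2) powr (- a)"
          using Cauchy_Schwarz_ineq2[of "grad u (x + t *\<^sub>R n)" n] n grad_le[of "x + t *\<^sub>R n" "d + t / 2"] pt d t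
          by simp
      qed
      moreover have "G (d + T / 2) \<le> G \<delta>" using G_mono[of "d + T / 2" \<delta>] p[OF T(1) order_refl] T d by simp
      then have "2 * C1 * G (d + T / 2) \<le> 2 * C1 * G \<delta>" using C1 by simp
      moreover have "\<bar>u (x + T *\<^sub>R n)\<bar> \<le> level_max \<Omega> u \<delta>"
        using abs_le_level_max[OF \<Omega>(1,2) continuous_on_C2[OF u] _ T(2) \<delta>] p[OF T(1) order_refl] by simp
      ultimately have "\<bar>u x\<bar> \<le> 2 * C1 * (G \<delta> - G d) + level_max \<Omega> u \<delta>"
        by (simp add: right_diff_distrib)
      then show ?thesis using G_mono[OF d] x(2) by (simp add: d_def)
    qed
    show "\<exists>\<delta>>0. (\<exists>z\<in>\<Omega>. bdist \<Omega> z = \<delta>) \<and>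
        (\<forall>u. Ck_on 2 u \<Omega> \<longrightarrow> distributional_solution p q \<Omega> u \<longrightarrow>
          (\<forall>G. (\<forall>s>0. (G has_real_derivative s powr (- (1 / (q + 1 - p)))) (at s)) \<longrightarrow>
            (\<forall>x\<in>{z\<in>\<Omega>. bdist \<Omega> z \<le> \<delta>}. G (bdist \<Omega> x) \<le> G \<delta> \<and>
               \<bar>u x\<bar> \<le> 2 * C1 * (G \<delta> - G (bdist \<Omega> x)) + level_max \<Omega> u \<delta>)))"
      using \<delta> level main unfolding a_def by blast
  qed
qed

theorem corollary2p3:
  fixes p q :: real
  assumes "CARD('n::finite) \<ge> 2" and "q > p - 1" and "p - 1 > 0"
  shows "\<exists>c>0. \<forall>\<Omega> :: (real ^ 'n) set. bounded \<Omega> \<longrightarrow> is_domain \<Omega> \<longrightarrow> C2_boundary \<Omega> \<longrightarrow>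
    (\<exists>\<delta>>0. (\<exists>z\<in>\<Omega>. bdist \<Omega> z = \<delta>) \<and>
      (\<forall>u. Ck_on 2 u \<Omega> \<longrightarrow> distributional_solution p q \<Omega> u \<longrightarrow>
        (p \<noteq> q \<longrightarrow> (\<forall>x\<in>{z\<in>\<Omega>. bdist \<Omega> z \<le> \<delta>}.
           \<bar>u x\<bar> \<le> c * \<bar>bdist \<Omega> x powr (- \<beta> p q) - \<delta> powr (- \<beta> p q)\<bar> + level_max \<Omega> u \<delta>)) \<and>
        (p = q \<longrightarrow> (\<forall>x\<in>{z\<in>\<Omega>. bdist \<Omega> z \<le> \<delta>}.
           \<bar>u x\<bar> \<le> c * (ln \<delta> - ln (bdist \<Omega> x)) + level_max \<Omega> u \<delta>))))"
proof -
  obtain C where C: "C > 0"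
    "\<forall>\<Omega> :: (real ^ 'n) set. open \<Omega> \<longrightarrow> bounded \<Omega> \<longrightarrow> \<Omega> \<noteq> {} \<longrightarrow> C2_boundary \<Omega> \<longrightarrow>
      (\<exists>\<delta>>0. (\<exists>z\<in>\<Omega>. bdist \<Omega> z = \<delta>) \<and>
        (\<forall>u. Ck_on 2 u \<Omega> \<longrightarrow> distributional_solution p q \<Omega> u \<longrightarrow>
          (\<forall>G. (\<forall>s>0. (G has_real_derivative s powr (- (1 / (q + 1 - p)))) (at s)) \<longrightarrow>
            (\<forall>x\<in>{z\<in>\<Omega>. bdist \<Omega> z \<le> \<delta>}. G (bdist \<Omega> x) \<le> G \<delta> \<and>
               \<bar>u x\<bar> \<le> C * (G \<delta> - G (bdist \<Omega> x)) + level_max \<Omega> u \<delta>))))"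
    using boundary_estimate[OF assms(2,3), where 'a = "real ^ 'n"] by (elim exE conjE) (rule that)
  \<comment> \<open>Equal to 1 - 1 / (q + 1 - p), the exponent of the antiderivative s^b / b of the
    gradient bound.\<close>
  define b where "b = - \<beta> p q"
  \<comment> \<open>The division by |b| comes from this antiderivative and introduces only p and
    q.\<close>
  define c where "c = (if p = q then C else C / \<bar>b\<bar>)"
  have b0: "b \<noteq> 0" if "p \<noteq> q" using that assms(2) by (simp add: b_def \<beta>_def)
  have "c > 0" using C(1) b0 by (simp add: c_def)
  moreover have "\<exists>\<delta>>0. (\<exists>z\<in>\<Omega>. bdist \<Omega> z = \<delta>) \<and>
      (\<forall>u. Ck_on 2 u \<Omega> \<longrightarrow> distributional_solution p q \<Omega> u \<longrightarrow>
        (p \<noteq> q \<longrightarrow> (\<forall>x\<in>{z\<in>\<Omega>. bdist \<Omega> z \<le> \<delta>}.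
           \<bar>u x\<bar> \<le> c * \<bar>bdist \<Omega> x powr b - \<delta> powr b\<bar> + level_max \<Omega> u \<delta>)) \<and>
        (p = q \<longrightarrow> (\<forall>x\<in>{z\<in>\<Omega>. bdist \<Omega> z \<le> \<delta>}.
           \<bar>u x\<bar> \<le> c * (ln \<delta> - ln (bdist \<Omega> x)) + level_max \<Omega> u \<delta>)))"
    if \<Omega>: "bounded \<Omega>" "is_domain \<Omega>" "C2_boundary \<Omega>" for \<Omega> :: "(real ^ 'n) set"
  proof -
    obtain \<delta> where \<delta>: "\<delta> > 0" "\<exists>z\<in>\<Omega>. bdist \<Omega> z = \<delta>" and est:
      "\<And>u G x. \<lbrakk>Ck_on 2 u \<Omega>; distributional_solution p q \<Omega> u;
        \<And>s. s > 0 \<Longrightarrow> (G has_real_derivative s powr (- (1 / (q + 1 - p)))) (at s); x \<in> {z\<in>\<Omega>. bdist \<Omega> z \<le> \<delta>}\<rbrakk> \<Longrightarrow>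
        G (bdist \<Omega> x) \<le> G \<delta> \<and> \<bar>u x\<bar> \<le> C * (G \<delta> - G (bdist \<Omega> x)) + level_max \<Omega> u \<delta>"
      using C(2)[rule_format, of \<Omega>] \<Omega> unfolding is_domain_def by blast
    have "\<bar>u x\<bar> \<le> c * \<bar>bdist \<Omega> x powr b - \<delta> powr b\<bar> + level_max \<Omega> u \<delta>"
      if u: "Ck_on 2 u \<Omega>" "distributional_solution p q \<Omega> u" and "p \<noteq> q" and x: "x \<in> {z\<in>\<Omega>. bdist \<Omega> z \<le> \<delta>}" for u x
    proof -
      have "b - 1 = - (1 / (q + 1 - p))" using assms(2) by (simp add: b_def \<beta>_def field_simps)
      then have "((\<lambda>s. s powr b / b) has_real_derivative s powr (- (1 / (q + 1 - p)))) (at s)" if "s > 0" for s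
        using DERIV_cdivide[OF has_real_derivative_powr[OF that, of b], of b] b0[OF \<open>p \<noteq> q\<close>] by simp
      from est[OF u this x] have "bdist \<Omega> x powr b / b \<le> \<delta> powr b / b"
        "\<bar>u x\<bar> \<le> C * (\<delta> powr b / b - bdist \<Omega> x powr b / b) + level_max \<Omega> u \<delta>" by auto
      \<comment> \<open>The left side is nonnegative by monotonicity of the antiderivative, so it
        equals its absolute value whatever the sign of \<open>b\<close>.\<close>
      moreover from this(1) have "\<delta> powr b / b - bdist \<Omega> x powr b / b = \<bar>\<delta> powr b - bdist \<Omega> x powr b\<bar> / \<bar>b\<bar>"
        by (simp add: abs_divide[symmetric] diff_divide_distrib)
      ultimately show ?thesis using \<open>p \<noteq> q\<close> by (simp add: c_def abs_minus_commute)
    qed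
    moreover have "\<bar>u x\<bar> \<le> c * (ln \<delta> - ln (bdist \<Omega> x)) + level_max \<Omega> u \<delta>"
      if u: "Ck_on 2 u \<Omega>" "distributional_solution p q \<Omega> u" and "p = q" and x: "x \<in> {z\<in>\<Omega>. bdist \<Omega> z \<le> \<delta>}" for u x
    proof -
      have "(ln has_real_derivative s powr (- (1 / (q + 1 - p)))) (at s)" if "s > 0" for s :: real
        using DERIV_ln[OF that] that \<open>p = q\<close> by (simp add: powr_minus)
      from est[OF u this x] show ?thesis using \<open>p = q\<close> by (simp add: c_def)
    qed
    ultimately show ?thesis using \<delta> by (intro exI[of _ \<delta>]) blast
  qed
  ultimately show ?thesis unfolding b_def by blast
qed

end
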